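(* Let $G$ be a cyclic group of even order $|G|\ge 4$ and let $H$ be a transfer Krull monoid over $G$. (1) There is no element $a\in H$ with $\rho(\mathsf L(a))=\rho(H)$ such that $\max\mathsf L(a)-1\in\mathsf L(a)$. (2) If $|G|+1$ is not a prime number, then there exist $a^*\in H$ and $M\in\mathbb N_0$ such that for all $a\in H$ with $\rho(\mathsf L(a))=\rho(H)$, the set $\mathsf L(a^*a)\cap[\min\mathsf L(a^*a),\ \max\mathsf L(a^*a)-M]$ is an interval and $\mathsf L(a^*a)$ has elasticity $\rho(H)$, i.e. $\rho(\mathsf L(a^*a))=\rho(H)$.
   Context: A monoid is a commutative cancellative semigroup with identity, written multiplicatively; $H^\times$ is its group of units; $a\simeq b$ means $aH=bH$. A non-unit $a\in H$ is an atom if $a=bc$ with $b,c\in H$ implies $b\in H^\times$ or $c\in H^\times$. $H$ is atomic if every non-unit is a finite product of atoms. For a non-unit $a$, the length set $\mathsf L(a)\subset\mathbb N$ is the set of all $k$ such that $a=u_1\cdots u_k$ with atoms $u_1,\dots,u_k$; for a unit $a$, $\mathsf L(a)=\{0\}$. For a finite nonempty $L\subset\mathbb N=\{1,2,\dots\}$, $\rho(L)=\max L/\min L$ is the elasticity of $L$, and $\rho(H)=\sup\rho(\mathsf L(a))$ over all non-units $a\in H$ is the elasticity of $H$. $[a,b]=\{x\in\mathbb Z: a\le x\le b\}$, and an interval is a finite nonempty set of consecutive integers. $\mathbb N_0=\{0,1,2,\dots\}$. For a finite abelian group $G$ (written additively), $\mathcal F(G)$ is the free abelian monoid with basis $G$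 (written multiplicatively), whose elements $S=g_1\cdots g_\ell$ are called sequences over $G$, with sum $\sigma(S)=g_1+\dots+g_\ell\in G$. $\mathcal B(G)=\{S\in\mathcal F(G):\sigma(S)=0\}$ is the monoid of zero-sum sequences over $G$. A transfer homomorphism $\theta:H\to B$ between atomic monoids is a monoid homomorphism such that (i) $B=\theta(H)B^\times$ and $\theta^{-1}(B^\times)=H^\times$; (ii) if $u\in H$, $b,c\in B$ and $\theta(u)=bc$, then there exist $v,w\in H$ with $u=vw$, $\theta(v)\simeq b$ and $\theta(w)\simeq c$. An (atomic) monoid $H$ is a transfer Krull monoid over $G$ if there exists a transfer homomorphism $\theta:H\to\mathcal B(G)$. *)

theory Defs
  imports "HOL-Algebra.Algebra" "HOL-Library.Extended_Real" "HOL-Library.Multiset"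
begin

text \<open>
  Monoids are the commutative cancellative monoids \<^locale>\<open>comm_monoid_cancel\<close>, the relation
  \<open>a \<simeq> b\<close> (that is, \<open>aH = bH\<close>) is \<^const>\<open>associated\<close>, and atoms are the irreducible elements. The
  library defines \<^const>\<open>irreducible\<close> through proper divisors; in a commutative cancellative
  monoid this is the usual condition on factorizations \<open>a = b c\<close>:
\<close>

lemma (in comm_monoid_cancel) irreducible_iff_atom:
  assumes "a \<in> carrier G"
  shows "irreducible G a \<longleftrightarrow>
    a \<notin> Units G \<and>
    (\<forall>b\<in>carrier G. \<forall>c\<in>carrier G. a = b \<otimes> c \<longrightarrow> b \<in> Units G \<or> c \<in> Units G)"
proof
  assume irr: "irreducible G a"
  then have "b \<in> Units G \<or> c \<in> Units G"
    if "b \<in> carrier G" "c \<in> carrier G" "a = b \<otimes> c" for b c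
    using that by (metis irreducible_prodE)
  with irr show "a \<notin> Units G \<and>
    (\<forall>b\<in>carrier G. \<forall>c\<in>carrier G. a = b \<otimes> c \<longrightarrow> b \<in> Units G \<or> c \<in> Units G)"
    by (auto simp: irreducible_def)
next
  assume R: "a \<notin> Units G \<and>
    (\<forall>b\<in>carrier G. \<forall>c\<in>carrier G. a = b \<otimes> c \<longrightarrow> b \<in> Units G \<or> c \<in> Units G)"
  show "irreducible G a"
  proof (rule irreducibleI)
    show "a \<notin> Units G" using R by blast
  next
    fix b assume b: "b \<in> carrier G" and pf: "properfactor G b a"
    from pf obtain c where c: "c \<in> carrier G" "a = b \<otimes> c"
      unfolding properfactor_def factor_def by blast
    have "c \<notin> Units G"
    proof
      assume "c \<in> Units G"
      then have "b = a \<otimes> inv c" "inv c \<in> carrier G"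
        using b c by (simp_all add: m_assoc)
      then have "a divides b" unfolding factor_def by blast
      with pf show False by (simp add: properfactor_def)
    qed
    with R b c show "b \<in> Units G" by blast
  qed
qed

locale atomic_monoid = comm_monoid_cancel +
  assumes atoms_exist:
    "\<lbrakk>a \<in> carrier G; a \<notin> Units G\<rbrakk> \<Longrightarrow> \<exists>us. set us \<subseteq> carrier G \<and> factors G us a"

definition length_set :: "('a, 'b) monoid_scheme \<Rightarrow> 'a \<Rightarrow> nat set"
  where "length_set H a =
    (if a \<in> Units H then {0}
     else {length us | us. set us \<subseteq> carrier H \<and> factors H us a})"

text \<open>
  The elasticity of a set of lengths is meant for finite nonempty sets of positive integers.
  For the set \<open>{0}\<close> of a unit the formula gives \<open>0 / 0 = 0\<close>, so a unit never attains the elasticity of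
  a monoid that has a non-unit with a finite nonempty set of lengths. The supremum is taken in the
  extended reals.
\<close>

definition elasticity :: "nat set \<Rightarrow> real"
  where "elasticity L = real (Max L) / real (Min L)"

definition monoid_elasticity :: "('a, 'b) monoid_scheme \<Rightarrow> ereal"
  where "monoid_elasticity H =
    (SUP a\<in>carrier H - Units H. ereal (elasticity (length_set H a)))"

definition int_interval :: "int set \<Rightarrow> bool"
  where "int_interval S \<longleftrightarrow> (\<exists>x y. x \<le> y \<and> S = {x..y})"

text \<open>
  Sequences over \<open>G\<close> are multisets of elements of \<open>G\<close>. Since \<open>G\<close> is written multiplicatively in the
  library, the sum of a sequence is a product here.
\<close>

definition seq_sum :: "('g, 'h) monoid_scheme \<Rightarrow> 'g multiset \<Rightarrow> 'g"
  where "seq_sum G S = (\<Otimes>\<^bsub>G\<^esub>g\<in>set_mset S. g [^]\<^bsub>G\<^esub> count S g)"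

definition zero_sum_monoid :: "('g, 'h) monoid_scheme \<Rightarrow> 'g multiset monoid"
  where "zero_sum_monoid G =
    \<lparr>carrier = {S. set_mset S \<subseteq> carrier G \<and> seq_sum G S = \<one>\<^bsub>G\<^esub>},
     monoid.mult = (+), one = {#}\<rparr>"

definition transfer_homomorphism ::
    "('a, 'b) monoid_scheme \<Rightarrow> ('c, 'd) monoid_scheme \<Rightarrow> ('a \<Rightarrow> 'c) \<Rightarrow> bool"
  where "transfer_homomorphism H B \<theta> \<longleftrightarrow>
    atomic_monoid H \<and> atomic_monoid B \<and>
    \<theta> \<in> hom H B \<and> \<theta> \<one>\<^bsub>H\<^esub> = \<one>\<^bsub>B\<^esub> \<and>
    carrier B = (\<theta> ` carrier H) <#>\<^bsub>B\<^esub> Units B \<and>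
    {a \<in> carrier H. \<theta> a \<in> Units B} = Units H \<and>
    (\<forall>u\<in>carrier H. \<forall>b\<in>carrier B. \<forall>c\<in>carrier B. \<theta> u = b \<otimes>\<^bsub>B\<^esub> c \<longrightarrow>
      (\<exists>v\<in>carrier H. \<exists>w\<in>carrier H.
        u = v \<otimes>\<^bsub>H\<^esub> w \<and> \<theta> v \<sim>\<^bsub>B\<^esub> b \<and> \<theta> w \<sim>\<^bsub>B\<^esub> c))"

definition transfer_Krull_monoid_over ::
    "('a, 'b) monoid_scheme \<Rightarrow> ('g, 'h) monoid_scheme \<Rightarrow> bool"
  where "transfer_Krull_monoid_over H G \<longleftrightarrow>
    atomic_monoid H \<and> (\<exists>\<theta>. transfer_homomorphism H (zero_sum_monoid G) \<theta>)"

text \<open>The monoid of zero-sum sequences is atomic, so the atomicity of the target in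
  \<^const>\<open>transfer_homomorphism\<close> is no restriction in \<^const>\<open>transfer_Krull_monoid_over\<close>.\<close>

lemma (in comm_group) seq_sum_superset:
  assumes "finite A" "A \<subseteq> carrier G" "set_mset S \<subseteq> A"
  shows "seq_sum G S = (\<Otimes>g\<in>A. g [^] count S g)"
  unfolding seq_sum_def
  by (rule finprod_mono_neutral_cong_left)
    (use assms in \<open>auto simp: not_in_iff\<close>)

lemma (in comm_group) seq_sum_union:
  assumes "set_mset S \<subseteq> carrier G" "set_mset T \<subseteq> carrier G"
  shows "seq_sum G (S + T) = seq_sum G S \<otimes> seq_sum G T"
proof -
  let ?A = "set_mset S \<union> set_mset T"
  have "seq_sum G (S + T) = (\<Otimes>g\<in>?A. g [^] count (S + T) g)"
    using assms by (intro seq_sum_superset) auto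
  also have "\<dots> = (\<Otimes>g\<in>?A. g [^] count S g \<otimes> g [^] count T g)"
    using assms by (intro finprod_cong') (auto simp: nat_pow_mult)
  also have "\<dots> = (\<Otimes>g\<in>?A. g [^] count S g) \<otimes> (\<Otimes>g\<in>?A. g [^] count T g)"
    using assms by (intro finprod_multf) auto
  also have "\<dots> = seq_sum G S \<otimes> seq_sum G T"
    using assms by (simp add: seq_sum_superset[of ?A])
  finally show ?thesis .
qed

lemma (in comm_group) seq_sum_closed:
  "set_mset S \<subseteq> carrier G \<Longrightarrow> seq_sum G S \<in> carrier G"
  unfolding seq_sum_def by (intro finprod_closed) auto

lemma (in comm_group) seq_sum_empty: "seq_sum G {#} = \<one>"
  by (simp add: seq_sum_def)

lemma zero_sum_monoid_simps [simp]:
  "S \<in> carrier (zero_sum_monoid G) \<longleftrightarrow> set_mset S \<subseteq> carrier G \<and> seq_sum G S = \<one>\<^bsub>G\<^esub>"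
  "S \<otimes>\<^bsub>zero_sum_monoid G\<^esub> T = S + T"
  "\<one>\<^bsub>zero_sum_monoid G\<^esub> = {#}"
  by (simp_all add: zero_sum_monoid_def)

lemma (in comm_group) zero_sum_monoid_cancel: "comm_monoid_cancel (zero_sum_monoid G)"
proof (rule comm_monoid_cancelI)
  show "comm_monoid (zero_sum_monoid G)"
    by (rule comm_monoidI) (auto simp: seq_sum_union seq_sum_empty add.assoc add.commute)
qed auto

lemma (in comm_group) Units_zero_sum_monoid: "Units (zero_sum_monoid G) = {{#}}"
  unfolding Units_def by (auto simp: seq_sum_empty)

lemma (in comm_group) zero_sum_monoid_atomic: "atomic_monoid (zero_sum_monoid G)"
proof -
  let ?B = "zero_sum_monoid G"
  interpret B: comm_monoid_cancel ?B by (rule zero_sum_monoid_cancel)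
  have ex: "\<exists>us. set us \<subseteq> carrier ?B \<and> factors ?B us S" if "S \<in> carrier ?B" for S
    using that
  proof (induction "size S" arbitrary: S rule: less_induct)
    case less
    consider "S \<in> Units ?B" | "irreducible ?B S"
      | T U where "T \<in> carrier ?B" "U \<in> carrier ?B" "S = T \<otimes>\<^bsub>?B\<^esub> U"
          "T \<notin> Units ?B" "U \<notin> Units ?B"
      using B.irreducible_iff_atom[OF less.prems] by blast
    then show ?case
    proof cases
      case 1
      then show ?thesis
        by (intro exI[of _ "[]"]) (simp add: Units_zero_sum_monoid factors_def)
    next
      case 2
      then show ?thesis
        using less.prems by (intro exI[of _ "[S]"]) (simp add: factors_def)
    next
      case 3
      have S: "S = T + U" using 3(3) by simp
      have "T \<noteq> {#}" "U \<noteq> {#}" using 3(4,5) by (auto simp: Units_zero_sum_monoid)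
      then have "size T < size S" "size U < size S"
        unfolding S by (simp_all add: nonempty_has_size)
      then obtain ts us where "set ts \<subseteq> carrier ?B" "factors ?B ts T"
        "set us \<subseteq> carrier ?B" "factors ?B us U"
        using less.hyps[OF _ 3(1)] less.hyps[OF _ 3(2)] by blast
      then have "factors ?B (ts @ us) S" "set (ts @ us) \<subseteq> carrier ?B"
        using B.factors_mult[of ts T us U] 3(3) by simp_all
      then show ?thesis by blast
    qed
  qed
  show ?thesis
    by unfold_locales (rule ex)
qed

end

theory Submission
  imports Defs
begin

text \<open>
  Write \<open>n\<close> for the order of the cyclic group \<open>G\<close>, and \<open>g\<close>, \<open>h\<close> for generators of \<open>G\<close>. Since the
  monoid of zero-sum sequences has no unit besides the empty sequence, a transfer homomorphism
  onto it preserves sets of lengths (\<open>transfer_length_set\<close>), and everything happens among zero-sum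
  sequences.

  The atoms there are the minimal zero-sum sequences. Their length is at most \<open>n\<close>, and at least
  \<open>2\<close> unless the atom is the identity of \<open>G\<close>. Comparing a shortest and a longest
  factorization of a sequence with its number of terms bounds the elasticity by \<open>n / 2\<close>.
  Equality leaves no freedom: some factorization has all its atoms of length \<open>n\<close>, and these are
  the powers \<open>g\<^sup>n\<close>; another one has all its atoms of length \<open>2\<close>, so \<open>g\<close> and \<open>inv g\<close> occur
  equally often. Hence the sequences of maximal elasticity are the products of blocks
  \<open>g\<^sup>n (inv g)\<^sup>n\<close> (\<open>maximal_elasticity_imp_sym_power\<close>), and \<open>d\<close> blocks have lengths between
  \<open>2 d\<close> and \<open>n d\<close>.

  For the first assertion let \<open>n\<close> be even. A zero-sum sequence of generators has an even number
  of terms, because generators are odd powers of a fixed generator. A factorization with one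
  atom less than the longest one has two terms in excess of two per atom, so it consists of one
  atom of length four and atoms \<open>g (inv g)\<close>. Cancelling the latter shows that the exceptional
  atom is invariant under inversion, so it is divisible by some \<open>g (inv g)\<close> and is no atom
  (\<open>penultimate_notin_lengths_sym_power\<close>).

  For the second assertion let \<open>n + 1 = a b\<close> with \<open>a, b > 1\<close> and put \<open>h = g\<^sup>a\<close>, so that
  \<open>g = h\<^sup>b\<close>. Then \<open>g\<^sup>n h\<^sup>n\<close>, a product of two atoms, is also a product of three atoms
  (\<open>four_five_mem_lengths\<close>). Multiplying by enough copies of the blocks of \<open>g\<close> and \<open>h\<close> therefore
  makes \<open>n + 1\<close> consecutive lengths available. Every further block contributes \<open>2\<close> or \<open>n\<close> to the
  length, and the steps of size \<open>n - 2\<close> between these contributions are bridged by the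
  consecutive lengths, starting at the very minimum. What is lost at the top depends only on the
  fixed factor (\<open>interval_lengths\<close>).
\<close>

section \<open>Transfer homomorphisms preserve sets of lengths\<close>

context
  fixes H :: "('a, 'b) monoid_scheme" and B :: "('c, 'd) monoid_scheme" and \<theta> :: "'a \<Rightarrow> 'c"
  assumes transfer: "transfer_homomorphism H B \<theta>"
    and reduced: "Units B = {\<one>\<^bsub>B\<^esub>}"
begin

interpretation H: atomic_monoid H
  using transfer by (simp add: transfer_homomorphism_def)

interpretation B: atomic_monoid B
  using transfer by (simp add: transfer_homomorphism_def)

lemma transfer_closed: "a \<in> carrier H \<Longrightarrow> \<theta> a \<in> carrier B"
  using transfer by (auto simp: transfer_homomorphism_def hom_def)

lemma transfer_mult:
  "\<lbrakk>a \<in> carrier H; b \<in> carrier H\<rbrakk> \<Longrightarrow> \<theta> (a \<otimes>\<^bsub>H\<^esub> b) = \<theta> a \<otimes>\<^bsub>B\<^esub> \<theta> b"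
  using transfer by (auto simp: transfer_homomorphism_def hom_def)

lemma transfer_one: "\<theta> \<one>\<^bsub>H\<^esub> = \<one>\<^bsub>B\<^esub>"
  using transfer by (simp add: transfer_homomorphism_def)

lemma transfer_Units_iff: "a \<in> carrier H \<Longrightarrow> \<theta> a \<in> Units B \<longleftrightarrow> a \<in> Units H"
  using transfer by (auto simp: transfer_homomorphism_def)

lemma transfer_surj:
  assumes "b \<in> carrier B"
  obtains a where "a \<in> carrier H" "\<theta> a = b"
proof -
  have "b \<in> (\<theta> ` carrier H) <#>\<^bsub>B\<^esub> Units B"
    using transfer assms by (simp add: transfer_homomorphism_def)
  then show ?thesis
    using that transfer_closed by (auto simp: set_mult_def reduced)
qed

lemma transfer_lift:
  assumes "u \<in> carrier H" "b \<in> carrier B" "c \<in> carrier B" "\<theta> u = b \<otimes>\<^bsub>B\<^esub> c"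
  obtains v w where "v \<in> carrier H" "w \<in> carrier H" "u = v \<otimes>\<^bsub>H\<^esub> w" "\<theta> v = b" "\<theta> w = c"
proof -
  have eq: "x = y" if "x \<sim>\<^bsub>B\<^esub> y" "x \<in> carrier B" "y \<in> carrier B" for x y
    using B.associatedD2[OF that(1)] that by (auto simp: reduced)
  obtain v w where "v \<in> carrier H" "w \<in> carrier H" "u = v \<otimes>\<^bsub>H\<^esub> w"
    "\<theta> v \<sim>\<^bsub>B\<^esub> b" "\<theta> w \<sim>\<^bsub>B\<^esub> c"
    using transfer assms unfolding transfer_homomorphism_def by blast
  with that show ?thesis
    using eq assms transfer_closed by blast
qed

lemma transfer_irreducible_iff:
  assumes "u \<in> carrier H"
  shows "irreducible B (\<theta> u) \<longleftrightarrow> irreducible H u"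
proof
  assume irr: "irreducible B (\<theta> u)"
  show "irreducible H u"
    unfolding H.irreducible_iff_atom[OF assms]
  proof (intro conjI ballI impI)
    show "u \<notin> Units H"
      using irr transfer_Units_iff[OF assms] by (simp add: irreducible_def)
    fix b c assume bc: "b \<in> carrier H" "c \<in> carrier H" "u = b \<otimes>\<^bsub>H\<^esub> c"
    then have "\<theta> b \<in> Units B \<or> \<theta> c \<in> Units B"
      using irr B.irreducible_iff_atom[OF transfer_closed[OF assms]]
      by (metis transfer_closed transfer_mult)
    then show "b \<in> Units H \<or> c \<in> Units H"
      using bc transfer_Units_iff by blast
  qed
next
  assume irr: "irreducible H u"
  show "irreducible B (\<theta> u)"
    unfolding B.irreducible_iff_atom[OF transfer_closed[OF assms]]
  proof (intro conjI ballI impI)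
    show "\<theta> u \<notin> Units B"
      using irr transfer_Units_iff[OF assms] by (simp add: irreducible_def)
    fix b c assume bc: "b \<in> carrier B" "c \<in> carrier B" "\<theta> u = b \<otimes>\<^bsub>B\<^esub> c"
    obtain v w where vw: "v \<in> carrier H" "w \<in> carrier H" "u = v \<otimes>\<^bsub>H\<^esub> w"
      "\<theta> v = b" "\<theta> w = c"
      using transfer_lift[OF assms bc] .
    then have "v \<in> Units H \<or> w \<in> Units H"
      using irr H.irreducible_iff_atom[OF assms] by blast
    then show "b \<in> Units B \<or> c \<in> Units B"
      using vw transfer_Units_iff by blast
  qed
qed

lemma transfer_factors:
  "\<lbrakk>set us \<subseteq> carrier H; factors H us a\<rbrakk> \<Longrightarrow> factors B (map \<theta> us) (\<theta> a)"
proof (induction us arbitrary: a)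
  case Nil
  then have "a = \<one>\<^bsub>H\<^esub>" by (simp add: factors_def)
  then show ?case by (simp add: factors_def transfer_one)
next
  case (Cons u us)
  have "set us \<subseteq> carrier H" "factors H us (foldr (\<otimes>\<^bsub>H\<^esub>) us \<one>\<^bsub>H\<^esub>)"
    using Cons.prems by (auto simp: factors_def)
  with Cons show ?case
    by (auto simp: factors_def transfer_irreducible_iff transfer_mult)
qed

text \<open>
  The lifting property splits off a preimage of one atom after the other, and a preimage of an
  atom is an atom.
\<close>

lemma factors_lift:
  assumes "vs \<noteq> []" "set vs \<subseteq> carrier B" "a \<in> carrier H" "factors B vs (\<theta> a)"
  shows "\<exists>us. set us \<subseteq> carrier H \<and> factors H us a \<and> length us = length vs"
  using assms
proof (induction vs arbitrary: a rule: list_nonempty_induct)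
  case (single v)
  \<comment> \<open>The induction starts at length one: an empty product lifts to a unit, which need not
    be the identity.\<close>
  then have "irreducible H a"
    using transfer_irreducible_iff by (auto simp: factors_def)
  with single show ?case
    by (intro exI[of _ "[a]"]) (auto simp: factors_def)
next
  case (cons v vs)
  define c where "c = foldr (\<otimes>\<^bsub>B\<^esub>) vs \<one>\<^bsub>B\<^esub>"
  have c: "c \<in> carrier B" "factors B vs c"
    using cons.prems by (auto simp: c_def factors_def)
  obtain x y where xy: "x \<in> carrier H" "y \<in> carrier H" "a = x \<otimes>\<^bsub>H\<^esub> y" "\<theta> x = v" "\<theta> y = c"
    using transfer_lift[of a v c] cons.prems c by (auto simp: factors_def c_def)
  then obtain us where us: "set us \<subseteq> carrier H" "factors H us y" "length us = length vs"
    using cons.IH[of y] cons.prems c by auto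
  have "irreducible H x"
    using xy cons.prems transfer_irreducible_iff[of x] by (auto simp: factors_def)
  with us xy show ?case
    by (intro exI[of _ "x # us"]) (auto simp: factors_def)
qed

proposition transfer_length_set:
  assumes "a \<in> carrier H"
  shows "length_set H a = length_set B (\<theta> a)"
proof (cases "a \<in> Units H")
  case True
  then show ?thesis
    using transfer_Units_iff[OF assms] by (simp add: length_set_def)
next
  case False
  then have nu: "\<theta> a \<notin> Units B"
    using transfer_Units_iff[OF assms] by simp
  have "\<exists>us. set us \<subseteq> carrier H \<and> factors H us a \<and> length us = length vs"
    if "set vs \<subseteq> carrier B" "factors B vs (\<theta> a)" for vs
  proof (rule factors_lift)
    show "vs \<noteq> []"
      using that nu by (auto simp: factors_def reduced)
  qed (use that assms in auto)
  moreover have "\<exists>vs. set vs \<subseteq> carrier B \<and> factors B vs (\<theta> a) \<and> length vs = length us"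
    if "set us \<subseteq> carrier H" "factors H us a" for us
    using that transfer_factors[OF that] transfer_closed
    by (intro exI[of _ "map \<theta> us"]) auto
  ultimately show ?thesis
    using False nu unfolding length_set_def by (auto; metis)
qed

proposition transfer_monoid_elasticity: "monoid_elasticity H = monoid_elasticity B"
proof -
  have "\<theta> ` (carrier H - Units H) = carrier B - Units B"
    using transfer_closed transfer_Units_iff by (auto elim!: transfer_surj)
  then have "monoid_elasticity B =
      (SUP a\<in>carrier H - Units H. ereal (elasticity (length_set B (\<theta> a))))"
    unfolding monoid_elasticity_def by (metis image_image)
  also have "\<dots> = monoid_elasticity H"
    unfolding monoid_elasticity_def by (intro SUP_cong) (auto simp: transfer_length_set)
  finally show ?thesis by simp
qed

end

section \<open>Zero-sum sequences and their factorizations\<close>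

context comm_group
begin

definition zero_sum :: "'a multiset \<Rightarrow> bool"
  where "zero_sum S \<longleftrightarrow> set_mset S \<subseteq> carrier G \<and> seq_sum G S = \<one>"

definition minimal_zero_sum :: "'a multiset \<Rightarrow> bool"
  where "minimal_zero_sum W \<longleftrightarrow> W \<noteq> {#} \<and> zero_sum W \<and>
    (\<forall>S T. zero_sum S \<longrightarrow> zero_sum T \<longrightarrow> W = S + T \<longrightarrow> S = {#} \<or> T = {#})"

definition zero_sum_free :: "'a multiset \<Rightarrow> bool"
  where "zero_sum_free S \<longleftrightarrow> set_mset S \<subseteq> carrier G \<and> (\<forall>T. T \<subseteq># S \<longrightarrow> zero_sum T \<longrightarrow> T = {#})"

text \<open>
  The set of lengths in the monoid of zero-sum sequences. Factorizations are multisets of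
  sequences, so that any chosen atom can be split off.
\<close>

definition lengths :: "'a multiset \<Rightarrow> nat set"
  where "lengths A = {size \<U> | \<U>. (\<forall>W\<in>#\<U>. minimal_zero_sum W) \<and> \<Sum>\<^sub># \<U> = A}"

definition subsums :: "'a multiset \<Rightarrow> 'a set"
  where "subsums S = seq_sum G ` {T. T \<subseteq># S}"

lemma seq_sum_singleton: "g \<in> carrier G \<Longrightarrow> seq_sum G {#g#} = g"
  by (simp add: seq_sum_def)

lemma seq_sum_add_mset:
  assumes "g \<in> carrier G" "set_mset S \<subseteq> carrier G"
  shows "seq_sum G (add_mset g S) = g \<otimes> seq_sum G S"
  using seq_sum_union[of "{#g#}" S] assms by (simp add: seq_sum_singleton)

lemma seq_sum_replicate: "g \<in> carrier G \<Longrightarrow> seq_sum G (replicate_mset k g) = g [^] k"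
proof (induction k)
  case 0
  then show ?case by (simp add: seq_sum_empty)
next
  case (Suc k)
  have "set_mset (replicate_mset k g) \<subseteq> carrier G"
    using Suc.prems by (auto simp: in_replicate_mset)
  then show ?case
    using Suc by (simp add: seq_sum_add_mset nat_pow_Suc2[symmetric])
qed

lemma seq_sum_image_pow:
  "g \<in> carrier G \<Longrightarrow> seq_sum G (image_mset (\<lambda>i. g [^] i) E) = g [^] (\<Sum>\<^sub># E :: nat)"
proof (induction E)
  case empty
  then show ?case by (simp add: seq_sum_empty)
next
  case (add i E)
  have "set_mset (image_mset (\<lambda>i. g [^] i) E) \<subseteq> carrier G"
    using add.prems by auto
  then show ?case
    using add by (simp add: seq_sum_add_mset nat_pow_mult)
qed

lemma zero_sum_freeD: "\<lbrakk>zero_sum_free S; T \<subseteq># S; zero_sum T\<rbrakk> \<Longrightarrow> T = {#}"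
  unfolding zero_sum_free_def by blast

lemma zero_sum_empty: "zero_sum {#}"
  by (simp add: zero_sum_def seq_sum_empty)

lemma zero_sum_plus: "\<lbrakk>zero_sum S; zero_sum T\<rbrakk> \<Longrightarrow> zero_sum (S + T)"
  by (auto simp: zero_sum_def seq_sum_union)

lemma zero_sum_cancel:
  assumes "zero_sum (S + T)" "zero_sum S"
  shows "zero_sum T"
  using assms seq_sum_union[of S T] seq_sum_closed[of T] by (auto simp: zero_sum_def)

lemma minimal_zero_sum_imp_zero_sum: "minimal_zero_sum W \<Longrightarrow> zero_sum W"
  by (simp add: minimal_zero_sum_def)

lemma minimal_zero_sum_nonempty: "minimal_zero_sum W \<Longrightarrow> W \<noteq> {#}"
  by (simp add: minimal_zero_sum_def)

lemma minimal_zero_sumD: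
  assumes "minimal_zero_sum W" "T \<subseteq># W" "zero_sum T" "T \<noteq> {#}"
  shows "T = W"
proof -
  obtain S where S: "W = T + S"
    using assms(2) by (metis mset_subset_eq_exists_conv)
  then have "zero_sum S"
    using assms zero_sum_cancel minimal_zero_sum_imp_zero_sum by blast
  then show ?thesis
    using assms S by (auto simp: minimal_zero_sum_def)
qed

lemma zero_sum_sum_mset: "(\<And>W. W \<in># \<U> \<Longrightarrow> minimal_zero_sum W) \<Longrightarrow> zero_sum (\<Sum>\<^sub># \<U>)"
  by (induction \<U>) (auto simp: zero_sum_empty zero_sum_plus minimal_zero_sum_imp_zero_sum)

lemma minimal_zero_sum_iff_irreducible:
  "minimal_zero_sum W \<longleftrightarrow>
    W \<in> carrier (zero_sum_monoid G) \<and> irreducible (zero_sum_monoid G) W"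
proof -
  interpret B: comm_monoid_cancel "zero_sum_monoid G"
    by (rule zero_sum_monoid_cancel)
  have carrier: "S \<in> carrier (zero_sum_monoid G) \<longleftrightarrow> zero_sum S" for S
    by (simp add: zero_sum_def)
  show ?thesis
    using B.irreducible_iff_atom[of W]
    unfolding carrier minimal_zero_sum_def Ball_def Units_zero_sum_monoid zero_sum_monoid_simps(2)
    by blast
qed

lemma lengths_empty: "lengths {#} = {0}"
proof -
  have "\<U> = {#}" if "\<forall>W\<in>#\<U>. minimal_zero_sum W" "\<Sum>\<^sub># \<U> = {#}" for \<U>
  proof (cases \<U>)
    case (add W \<U>')
    then show ?thesis
      using that minimal_zero_sum_nonempty by auto
  qed
  then show ?thesis
    unfolding lengths_def by (auto intro!: exI[of _ "{#}"])
qed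

lemma length_set_zero_sum_monoid:
  assumes "zero_sum A"
  shows "length_set (zero_sum_monoid G) A = lengths A"
proof -
  let ?B = "zero_sum_monoid G"
  have foldr: "foldr (\<otimes>\<^bsub>?B\<^esub>) us {#} = \<Sum>\<^sub># (mset us)" for us
    by (induction us) auto
  have factors: "set us \<subseteq> carrier ?B \<and> factors ?B us A \<longleftrightarrow>
      (\<forall>W\<in>set us. minimal_zero_sum W) \<and> \<Sum>\<^sub># (mset us) = A" for us
    unfolding factors_def minimal_zero_sum_iff_irreducible zero_sum_monoid_simps(3) foldr subset_eq
    by blast
  have eq: "{length us | us. set us \<subseteq> carrier ?B \<and> factors ?B us A} = lengths A"
  proof (intro equalityI subsetI)
    fix k assume "k \<in> {length us | us. set us \<subseteq> carrier ?B \<and> factors ?B us A}"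
    then obtain us where "k = length us" "\<forall>W\<in>set us. minimal_zero_sum W" "\<Sum>\<^sub># (mset us) = A"
      using factors by blast
    then show "k \<in> lengths A"
      unfolding lengths_def by (intro CollectI exI[of _ "mset us"]) auto
  next
    fix k assume "k \<in> lengths A"
    then obtain \<U> where "k = size \<U>" "\<forall>W\<in>#\<U>. minimal_zero_sum W" "\<Sum>\<^sub># \<U> = A"
      unfolding lengths_def by blast
    moreover obtain us where "mset us = \<U>"
      using ex_mset by blast
    ultimately have "k = length us" "\<forall>W\<in>set us. minimal_zero_sum W" "\<Sum>\<^sub># (mset us) = A"
      by auto
    then show "k \<in> {length us | us. set us \<subseteq> carrier ?B \<and> factors ?B us A}"
      using factors by blast
  qed
  then show ?thesis
    using lengths_empty unfolding length_set_def Units_zero_sum_monoid by auto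
qed

lemma lengths_nonempty:
  assumes "zero_sum A"
  shows "lengths A \<noteq> {}"
proof -
  interpret B: atomic_monoid "zero_sum_monoid G"
    by (rule zero_sum_monoid_atomic)
  have "length_set (zero_sum_monoid G) A \<noteq> {}"
    using B.atoms_exist[of A] assms unfolding length_set_def zero_sum_def by auto
  then show ?thesis
    using assms by (simp add: length_set_zero_sum_monoid)
qed

lemma lengths_plus:
  assumes "k \<in> lengths A" "l \<in> lengths B"
  shows "k + l \<in> lengths (A + B)"
proof -
  obtain \<U> \<V> where "\<forall>W\<in>#\<U>. minimal_zero_sum W" "\<Sum>\<^sub># \<U> = A" "k = size \<U>"
    "\<forall>W\<in>#\<V>. minimal_zero_sum W" "\<Sum>\<^sub># \<V> = B" "l = size \<V>"
    using assms unfolding lengths_def by blast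
  then show ?thesis
    unfolding lengths_def by (intro CollectI exI[of _ "\<U> + \<V>"]) auto
qed

lemma lengthsI: "(\<And>W. W \<in># \<U> \<Longrightarrow> minimal_zero_sum W) \<Longrightarrow> size \<U> \<in> lengths (\<Sum>\<^sub># \<U>)"
  unfolding lengths_def by blast

text \<open>
  The exponents add up to the order of \<open>g\<close> itself, not only to a multiple of it, so a
  proper nonempty part has an exponent sum strictly between zero and the order.
\<close>

lemma minimal_zero_sum_index_one:
  assumes g: "g \<in> carrier G" and E: "\<And>i. i \<in># E \<Longrightarrow> 0 < i" "\<Sum>\<^sub># E = ord g" "0 < ord g"
  shows "minimal_zero_sum (image_mset (\<lambda>i. g [^] i) E)"
  unfolding minimal_zero_sum_def
proof (intro conjI allI impI)
  show "image_mset (\<lambda>i. g [^] i) E \<noteq> {#}"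
    using E by auto
  show "zero_sum (image_mset (\<lambda>i. g [^] i) E)"
    using g E by (auto simp: zero_sum_def seq_sum_image_pow)
  fix S T assume ST: "zero_sum S" "zero_sum T" "image_mset (\<lambda>i. g [^] i) E = S + T"
  obtain E1 E2 where split: "E = E1 + E2" "S = image_mset (\<lambda>i. g [^] i) E1"
    "T = image_mset (\<lambda>i. g [^] i) E2"
    using image_mset_eq_plusD[OF ST(3)] by blast
  have dvd: "ord g dvd \<Sum>\<^sub># E1" "ord g dvd \<Sum>\<^sub># E2"
    using ST g by (auto simp: split zero_sum_def seq_sum_image_pow pow_eq_id)
  have sum: "\<Sum>\<^sub># E1 + \<Sum>\<^sub># E2 = ord g"
    using E by (simp add: split)
  have "\<Sum>\<^sub># E1 = 0 \<or> \<Sum>\<^sub># E2 = 0"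
  proof (rule disjCI, rule ccontr)
    assume ne: "\<Sum>\<^sub># E2 \<noteq> 0" "\<Sum>\<^sub># E1 \<noteq> 0"
    have "ord g \<le> \<Sum>\<^sub># E1" "ord g \<le> \<Sum>\<^sub># E2"
      by (rule dvd_imp_le[OF dvd(1) neq0_conv[THEN iffD1, OF ne(2)]],
          rule dvd_imp_le[OF dvd(2) neq0_conv[THEN iffD1, OF ne(1)]])
    then show False using sum \<open>0 < ord g\<close> by linarith
  qed
  moreover have "F = {#}" if "F \<subseteq># E" "\<Sum>\<^sub># F = 0" for F
  proof (rule ccontr)
    assume "F \<noteq> {#}"
    then obtain i where "i \<in># F" by blast
    then have "i \<in># E" "i = 0"
      using that by (auto dest: mset_subset_eqD)
    then show False
      using E(1) by blast
  qed
  moreover have "E1 \<subseteq># E" "E2 \<subseteq># E"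
    by (simp_all add: split)
  ultimately have "E1 = {#} \<or> E2 = {#}"
    by blast
  then show "S = {#} \<or> T = {#}"
    using split by auto
qed

lemma minimal_zero_sum_replicate:
  assumes "g \<in> carrier G" "0 < ord g"
  shows "minimal_zero_sum (replicate_mset (ord g) g)"
  using minimal_zero_sum_index_one[of g "replicate_mset (ord g) 1"] assms
  by (auto simp: image_replicate_mset)

lemma zero_sum_pair: "g \<in> carrier G \<Longrightarrow> zero_sum {#g, inv g#}"
  by (simp add: zero_sum_def seq_sum_add_mset seq_sum_empty)

lemma minimal_zero_sum_one: "minimal_zero_sum W \<Longrightarrow> \<one> \<in># W \<Longrightarrow> W = {#\<one>#}"
  using minimal_zero_sumD[of W "{#\<one>#}"] by (simp add: zero_sum_def seq_sum_singleton)

lemma minimal_zero_sum_pair: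
  assumes "g \<in> carrier G" "g \<noteq> \<one>"
  shows "minimal_zero_sum {#g, inv g#}"
  unfolding minimal_zero_sum_def
proof (intro conjI allI impI)
  fix S T assume ST: "zero_sum S" "zero_sum T" "{#g, inv g#} = S + T"
  have single: "T \<noteq> {#h#}" if "zero_sum T" "T \<subseteq># {#g, inv g#}" for T h
  proof
    assume T: "T = {#h#}"
    then have "h = g \<or> h = inv g" "h = \<one>"
      using that seq_sum_singleton[of h] by (auto simp: zero_sum_def)
    then have "g = \<one>"
      using assms by (metis inv_inv inv_one)
    then show False using assms by simp
  qed
  have "size S + size T = 2"
    using arg_cong[OF ST(3), of size] by simp
  moreover have "size S \<noteq> 1" "size T \<noteq> 1"
    using single[of S] single[of T] ST size_1_singleton_mset
    by (metis mset_subset_eq_add_left mset_subset_eq_add_right)+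
  ultimately have "size S = 0 \<or> size T = 0" by linarith
  then show "S = {#} \<or> T = {#}" by simp
qed (use zero_sum_pair assms in auto)

lemma zero_sum_size_2:
  assumes "zero_sum V" "size V = 2"
  obtains g where "g \<in> carrier G" "V = {#g, inv g#}"
proof -
  obtain g V' where V': "V = add_mset g V'"
    using assms(2) size_eq_Suc_imp_eq_union[of V 1] by auto
  then obtain h where V: "V = {#g, h#}"
    using assms(2) size_1_singleton_mset[of V'] by auto
  then have "g \<in> carrier G" "h \<in> carrier G" "g \<otimes> h = \<one>"
    using assms by (auto simp: zero_sum_def seq_sum_add_mset seq_sum_empty)
  then have "h = inv g"
    using inv_equality[of h g] m_comm[of g h] by simp
  with V \<open>g \<in> carrier G\<close> that show ?thesis by blast
qed

section \<open>The length of minimal zero-sum sequences\<close>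

text \<open>
  If adding \<open>g\<close> to \<open>S\<close> gave no new subsequence sum, then the set of subsequence sums of \<open>S\<close>
  would be stable under multiplication by \<open>g\<close>. It contains the identity (the sum of the empty
  sequence), hence also the inverse of \<open>g\<close>, and \<open>g\<close> would complete a nonempty
  zero-sum subsequence.
\<close>

lemma card_subsums_add_mset:
  assumes fin: "finite (carrier G)" and free: "zero_sum_free (add_mset g S)"
  shows "card (subsums S) < card (subsums (add_mset g S))"
proof (rule ccontr)
  assume "\<not> ?thesis"
  then have le: "card (subsums (add_mset g S)) \<le> card (subsums S)" by simp
  have g: "g \<in> carrier G" and S: "set_mset S \<subseteq> carrier G"
    using free by (auto simp: zero_sum_free_def)
  have closed: "subsums T \<subseteq> carrier G" if "set_mset T \<subseteq> carrier G" for T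
    using that by (auto simp: subsums_def intro!: seq_sum_closed dest!: set_mset_mono)
  then have "finite (subsums T)" if "set_mset T \<subseteq> carrier G" for T
    using fin that finite_subset by blast
  then have fins: "finite (subsums S)" "finite (subsums (add_mset g S))"
    using g S by auto
  have "subsums S \<subseteq> subsums (add_mset g S)"
    unfolding subsums_def using subset_mset.order_trans by (intro image_mono) force
  then have eq: "subsums (add_mset g S) = subsums S"
    using le fins by (metis card_seteq)
  have "(\<lambda>x. g \<otimes> x) ` subsums S \<subseteq> subsums (add_mset g S)"
  proof
    fix y assume "y \<in> (\<lambda>x. g \<otimes> x) ` subsums S"
    then obtain T where T: "T \<subseteq># S" "y = g \<otimes> seq_sum G T"
      by (auto simp: subsums_def)
    then have "y = seq_sum G (add_mset g T)"
      using g S by (subst seq_sum_add_mset) (auto dest: set_mset_mono)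
    then show "y \<in> subsums (add_mset g S)"
      using T by (auto simp: subsums_def)
  qed
  moreover have "inj_on (\<lambda>x. g \<otimes> x) (subsums S)"
    using g closed[OF S] by (intro inj_onI) (metis l_cancel subsetD)
  ultimately have "(\<lambda>x. g \<otimes> x) ` subsums S = subsums S"
    using eq fins by (metis endo_inj_surj)
  moreover have "\<one> \<in> subsums S"
    by (auto simp: subsums_def seq_sum_empty intro!: image_eqI[of _ _ "{#}"])
  ultimately obtain T where T: "T \<subseteq># S" "\<one> = g \<otimes> seq_sum G T"
    by (auto simp: subsums_def elim!: equalityE)
  then have "zero_sum (add_mset g T)" "add_mset g T \<subseteq># add_mset g S"
    using g S set_mset_mono[OF T(1)] by (auto simp: zero_sum_def seq_sum_add_mset)
  from zero_sum_freeD[OF free this(2,1)] show False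
    by simp
qed

lemma card_subsums_plus:
  assumes "finite (carrier G)" "zero_sum_free (S + T)"
  shows "card (subsums S) + size T \<le> card (subsums (S + T))"
  using assms(2)
proof (induction T)
  case (add g T)
  have "zero_sum_free (S + T)"
    using add.prems subset_mset.order_trans[of _ "S + T" "S + add_mset g T"]
    by (auto simp: zero_sum_free_def)
  then show ?case
    using add.IH card_subsums_add_mset[OF assms(1), of g "S + T"] add.prems by simp
qed simp

lemma card_subsums_le_order:
  assumes "finite (carrier G)" "set_mset S \<subseteq> carrier G"
  shows "card (subsums S) \<le> order G"
proof -
  have "subsums S \<subseteq> carrier G"
    using assms by (auto simp: subsums_def intro!: seq_sum_closed dest!: set_mset_mono)
  then show ?thesis
    unfolding order_def using assms by (intro card_mono)
qed

lemma minimal_zero_sum_imp_zero_sum_free: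
  assumes "minimal_zero_sum (add_mset g S)"
  shows "zero_sum_free S"
proof -
  have "T = {#}" if "T \<subseteq># S" "zero_sum T" for T
  proof (rule ccontr)
    assume "T \<noteq> {#}"
    moreover have "T \<subseteq># add_mset g S"
      using that(1) by (metis add_mset_add_single mset_subset_eq_add_left subset_mset.order_trans)
    ultimately have "T = add_mset g S"
      using minimal_zero_sumD[OF assms] that by blast
    then show False
      using size_mset_mono[OF that(1)] by simp
  qed
  then show ?thesis
    using minimal_zero_sum_imp_zero_sum[OF assms] by (auto simp: zero_sum_free_def zero_sum_def)
qed

text \<open>
  Removing one term leaves a zero-sum free sequence; starting with the sum of the empty
  sequence, each of its terms adds at least one subsequence sum.
\<close>

proposition size_minimal_zero_sum_le_order:
  assumes "finite (carrier G)" "minimal_zero_sum W"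
  shows "size W \<le> order G"
proof -
  obtain g S where W: "W = add_mset g S"
    using minimal_zero_sum_nonempty[OF assms(2)] multiset_cases by blast
  then have free: "zero_sum_free S"
    using assms minimal_zero_sum_imp_zero_sum_free by blast
  have "card (subsums {#}) = 1"
    by (simp add: subsums_def)
  then have "1 + size S \<le> order G"
    using card_subsums_plus[of "{#}" S] card_subsums_le_order[of S] assms(1) free
    by (auto simp: zero_sum_free_def)
  then show ?thesis by (simp add: W)
qed

text \<open>
  Two distinct terms \<open>g\<close> and \<open>h\<close> already have four subsequence sums, one more than the
  general growth provides, and this rules out the maximal length.
\<close>

proposition minimal_zero_sum_of_size_order:
  assumes order: "order G \<ge> 3" and W: "minimal_zero_sum W" "size W = order G"
  obtains g where "g \<in> carrier G" "ord g = order G" "W = replicate_mset (order G) g"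
proof -
  have fin: "finite (carrier G)"
    using order order_gt_0_iff_finite by simp
  have closed: "set_mset W \<subseteq> carrier G"
    using W by (simp add: minimal_zero_sum_def zero_sum_def)
  obtain g where gW: "g \<in># W"
    using minimal_zero_sum_nonempty[OF W(1)] by blast
  then have g: "g \<in> carrier G" using closed by blast
  have "h = g" if hW: "h \<in># W" for h
  proof (rule ccontr)
    assume ne: "h \<noteq> g"
    have h: "h \<in> carrier G" using hW closed by blast
    obtain R where R: "W = add_mset g (add_mset h R)"
      by (metis gW hW ne insert_DiffM insert_noteq_member)
    then have "size R \<noteq> 0" using W order by auto
    then obtain x R' where R': "R = add_mset x R'"
      by (metis multiset_cases size_empty)
    have "W = add_mset x ({#g, h#} + R')"
      by (simp add: R R')
    then have free: "zero_sum_free ({#g, h#} + R')"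
      using W minimal_zero_sum_imp_zero_sum_free by metis
    then have nz: "seq_sum G T \<noteq> \<one>" if "T \<subseteq># {#g, h#}" "T \<noteq> {#}" for T
    proof -
      have "T \<subseteq># {#g, h#} + R'"
        using that(1) by (rule subset_mset.add_increasing2[rotated]) simp
      moreover have "set_mset T \<subseteq> carrier G"
        using set_mset_mono[OF that(1)] g h by auto
      ultimately show ?thesis
        using free that(2) by (auto simp: zero_sum_free_def zero_sum_def)
    qed
    have "g \<noteq> \<one>" "h \<noteq> \<one>" "g \<otimes> h \<noteq> \<one>"
      using nz[of "{#g#}"] nz[of "{#h#}"] nz[of "{#g, h#}"] g h
      by (auto simp: seq_sum_add_mset seq_sum_empty)
    then have "card {\<one>, g, h, g \<otimes> h} = 4"
      using g h ne by auto
    moreover have "{\<one>, g, h, g \<otimes> h} \<subseteq> subsums {#g, h#}"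
    proof -
      have "seq_sum G ` {{#}, {#g#}, {#h#}, {#g, h#}} \<subseteq> subsums {#g, h#}"
        unfolding subsums_def by (intro image_mono) auto
      then show ?thesis
        using g h by (simp add: seq_sum_add_mset seq_sum_empty)
    qed
    moreover have "finite (subsums {#g, h#})"
      using fin g h by (intro finite_subset[of "subsums {#g, h#}" "carrier G"])
        (auto simp: subsums_def intro!: seq_sum_closed dest!: set_mset_mono)
    ultimately have "4 \<le> card (subsums {#g, h#})"
      by (metis card_mono)
    then have "4 + size R' \<le> order G"
      using card_subsums_plus[OF fin free] card_subsums_le_order[of "{#g, h#} + R'"] fin free
      by (auto simp: zero_sum_free_def)
    then show False
      using W R R' by simp
  qed
  then have "set_mset W \<subseteq> {g}" by blast
  then have W': "W = replicate_mset (order G) g"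
    using set_mset_subset_singletonD W by metis
  have pos: "0 < ord g"
    using ord_ge_1[OF fin g] by simp
  have "zero_sum (replicate_mset (ord g) g)"
    using g by (auto simp: zero_sum_def seq_sum_replicate in_replicate_mset)
  moreover have "replicate_mset (ord g) g \<subseteq># W"
    unfolding W' using ord_le_group_order[OF fin g]
    by (auto simp: subseteq_mset_def)
  ultimately have "replicate_mset (ord g) g = W"
    using minimal_zero_sumD[OF W(1)] pos by auto
  then have "ord g = order G"
    using W by (metis size_replicate_mset)
  with that g W' show ?thesis by blast
qed

end

section \<open>Sequences of maximal elasticity over a cyclic group\<close>

lemma sum_mset_eq_upper_bound:
  fixes f :: "'a \<Rightarrow> nat"
  assumes "\<And>x. x \<in># M \<Longrightarrow> f x \<le> c" "(\<Sum>x\<in>#M. f x) = c * size M" "x \<in># M"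
  shows "f x = c"
proof -
  obtain R where R: "M = add_mset x R"
    using assms(3) by (metis insert_DiffM)
  have "(\<Sum>x\<in>#R. f x) \<le> (\<Sum>x\<in>#R. c)"
    using assms(1) R by (intro sum_mset_mono) auto
  then show ?thesis
    using assms(1)[OF assms(3)] assms(2) by (simp add: R mult.commute)
qed

lemma sum_mset_eq_lower_bound:
  fixes f :: "'a \<Rightarrow> nat"
  assumes "\<And>x. x \<in># M \<Longrightarrow> c \<le> f x" "(\<Sum>x\<in>#M. f x) = c * size M" "x \<in># M"
  shows "f x = c"
proof -
  obtain R where R: "M = add_mset x R"
    using assms(3) by (metis insert_DiffM)
  have "(\<Sum>x\<in>#R. c) \<le> (\<Sum>x\<in>#R. f x)"
    using assms(1) R by (intro sum_mset_mono) auto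
  then show ?thesis
    using assms(1)[OF assms(3)] assms(2) by (simp add: R mult.commute)
qed

lemma member_subset_sum_mset:
  assumes "S \<in># M"
  shows "S \<subseteq># \<Sum>\<^sub># M"
proof -
  obtain R where "M = add_mset S R"
    using assms by (metis insert_DiffM)
  then show ?thesis by simp
qed

locale cyclic_group_order_ge_3 = group +
  assumes cyclic: "cyclic_group G" and order_ge_3: "order G \<ge> 3"

sublocale cyclic_group_order_ge_3 \<subseteq> comm_group
  using cyclic by (rule cyclic_imp_abelian_group)

context cyclic_group_order_ge_3
begin

abbreviation generators :: "'a set"
  where "generators \<equiv> {g \<in> carrier G. ord g = order G}"

text \<open>
  The product of the blocks \<open>g\<^sup>n (inv g)\<^sup>n\<close> with \<open>g\<close> in \<open>D\<close> and \<open>n\<close> the order of the group. If all these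
  \<open>g\<close> are generators, a block is a product of two atoms of the largest length \<open>n\<close>, and also of
  \<open>n\<close> atoms of length two.
\<close>

definition sym_power :: "'a multiset \<Rightarrow> 'a multiset"
  where "sym_power D =
    (\<Sum>g\<in>#D. replicate_mset (order G) g + replicate_mset (order G) (inv g))"

definition symmetric :: "'a multiset \<Rightarrow> bool"
  where "symmetric S \<longleftrightarrow> (\<forall>g\<in>carrier G. count S g = count S (inv g))"

lemma finite_carrier: "finite (carrier G)"
  using order_ge_3 order_gt_0_iff_finite by simp

lemma generator_exists: "\<exists>g. g \<in> generators"
proof -
  obtain g where g: "g \<in> carrier G" "subgroup_generated G {g} = G"
    using cyclic by (auto simp: cyclic_group_def)
  then have "generate G {g} = carrier G"
    by (metis carrier_subgroup_generated Int_insert_right_if1 Int_empty_right)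
  then show ?thesis
    using g generate_pow_card[of g] by (auto simp: order_def)
qed

lemma inv_generator: "g \<in> generators \<Longrightarrow> inv g \<in> generators"
  by simp

lemma generator_neq_one: "g \<in> generators \<Longrightarrow> g \<noteq> \<one>"
  using order_ge_3 by auto

lemma generator_neq_inv:
  assumes "g \<in> generators"
  shows "inv g \<noteq> g"
proof
  assume eq: "inv g = g"
  have g: "g \<in> carrier G" using assms by simp
  then have "g [^] (2::nat) = g \<otimes> inv g"
    by (simp add: eq numeral_2_eq_2)
  then have "ord g dvd 2"
    using g by (simp add: pow_eq_id)
  then show False
    using assms order_ge_3 by (auto dest: dvd_imp_le)
qed

lemma minimal_zero_sum_generator_power:
  "g \<in> generators \<Longrightarrow> minimal_zero_sum (replicate_mset (order G) g)"
  using minimal_zero_sum_replicate[of g] order_ge_3 by simp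

lemma sym_power_empty [simp]: "sym_power {#} = {#}"
  by (simp add: sym_power_def)

lemma sym_power_add_mset [simp]: "sym_power (add_mset g D) =
    replicate_mset (order G) g + replicate_mset (order G) (inv g) + sym_power D"
  by (simp add: sym_power_def)

lemma sym_power_plus: "sym_power (D + E) = sym_power D + sym_power E"
  by (simp add: sym_power_def)

lemma size_sym_power: "size (sym_power D) = 2 * order G * size D"
  by (induction D) auto

lemma set_sym_power: "set_mset D \<subseteq> generators \<Longrightarrow> set_mset (sym_power D) \<subseteq> generators"
  by (induction D) auto

lemma symmetric_empty: "symmetric {#}"
  by (simp add: symmetric_def)

lemma symmetric_plus: "symmetric S \<Longrightarrow> symmetric T \<Longrightarrow> symmetric (S + T)"
  unfolding symmetric_def count_union by metis

lemma symmetric_cancel: "symmetric (S + T) \<Longrightarrow> symmetric S \<Longrightarrow> symmetric T"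
  unfolding symmetric_def count_union by (metis add_left_cancel)

lemma symmetric_pair:
  assumes "g \<in> carrier G"
  shows "symmetric {#g, inv g#}"
proof -
  have count: "count {#g, inv g#} x = (if x = g then 1 else 0) + (if x = inv g then 1 else 0)" for x
    by auto
  have "count {#g, inv g#} h = count {#g, inv g#} (inv h)" if h: "h \<in> carrier G" for h
  proof -
    have eqs: "h = g \<longleftrightarrow> inv h = inv g" "h = inv g \<longleftrightarrow> inv h = g"
      using inv_inv[OF h] inv_inv[OF assms] by metis+
    show ?thesis
      unfolding count eqs by (rule add.commute)
  qed
  then show ?thesis
    unfolding symmetric_def by blast
qed

lemma symmetric_sum_mset: "(\<And>S. S \<in># M \<Longrightarrow> symmetric S) \<Longrightarrow> symmetric (\<Sum>\<^sub># M)"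
  by (induction M) (simp_all add: symmetric_empty symmetric_plus)

lemma symmetric_zero_sum_size_2: "\<lbrakk>zero_sum V; size V = 2\<rbrakk> \<Longrightarrow> symmetric V"
  by (metis zero_sum_size_2 symmetric_pair)

lemma symmetric_sym_power: "set_mset D \<subseteq> generators \<Longrightarrow> symmetric (sym_power D)"
proof (induction D)
  case (add g D)
  have "replicate_mset k g + replicate_mset k (inv g) = (\<Sum>\<^sub># (replicate_mset k {#g, inv g#}))" for k
    by (induction k) auto
  then have "symmetric (replicate_mset (order G) g + replicate_mset (order G) (inv g))"
    using add.prems symmetric_pair by (auto intro!: symmetric_sum_mset split: if_splits)
  then show ?case
    using add by (simp add: symmetric_plus)
qed (simp add: symmetric_empty)

lemma symmetric_decompose:
  "\<lbrakk>symmetric C; set_mset C \<subseteq> generators\<rbrakk> \<Longrightarrow>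
    \<exists>D. set_mset D \<subseteq> generators \<and> C = D + image_mset (m_inv G) D"
proof (induction "size C" arbitrary: C rule: less_induct)
  case less
  show ?case
  proof (cases C)
    case empty
    then show ?thesis by (intro exI[of _ "{#}"]) simp
  next
    case (add g C')
    then have g: "g \<in> generators" using less.prems by auto
    have "count C (inv g) = count C g"
      using less.prems g unfolding symmetric_def by (metis mem_Collect_eq)
    then have "inv g \<in># C'"
      using add generator_neq_inv[OF g] by (auto simp flip: count_greater_zero_iff)
    then obtain C'' where "C' = add_mset (inv g) C''"
      by (metis insert_DiffM)
    then have C: "C = {#g, inv g#} + C''"
      using add by simp
    then have "symmetric C''"
      using less.prems symmetric_pair[of g] symmetric_cancel g by blast
    then obtain D where "set_mset D \<subseteq> generators" "C'' = D + image_mset (m_inv G) D"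
      using less.hyps[of C''] less.prems C by auto
    then show ?thesis
      using g C by (intro exI[of _ "add_mset g D"]) auto
  qed
qed

text \<open>
  The identity of the group is the only atom of length one. Its multiplicity enters with weights
  that make both bounds sharp for this atom as well; being additive, the bounds can then be summed
  over the atoms of any factorization.
\<close>

lemma minimal_zero_sum_bounds:
  assumes "minimal_zero_sum W"
  shows "2 \<le> size W + count W \<one>"
    and "size W + (order G - 1) * count W \<one> \<le> order G"
proof -
  have "size W \<noteq> 0"
    using minimal_zero_sum_nonempty[OF assms] by simp
  moreover have "\<one> \<in># W" if "size W = 1"
  proof -
    obtain g where "W = {#g#}"
      using size_1_singleton_mset \<open>size W = 1\<close> by blast
    then show ?thesis
      using minimal_zero_sum_imp_zero_sum[OF assms]
      by (auto simp: zero_sum_def seq_sum_singleton)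
  qed
  ultimately show "2 \<le> size W + count W \<one>"
    using count_greater_zero_iff[of W \<one>] by linarith
  show "size W + (order G - 1) * count W \<one> \<le> order G"
  proof (cases "\<one> \<in># W")
    case True
    then show ?thesis
      using minimal_zero_sum_one[OF assms] order_ge_3 by simp
  next
    case False
    then show ?thesis
      using size_minimal_zero_sum_le_order[OF finite_carrier assms] by (simp add: not_in_iff)
  qed
qed

lemma lengths_bounds:
  assumes "k \<in> lengths A"
  shows "2 * k \<le> size A + count A \<one>"
    and "size A + (order G - 1) * count A \<one> \<le> order G * k"
proof -
  obtain \<U> where U: "\<forall>W\<in>#\<U>. minimal_zero_sum W" "\<Sum>\<^sub># \<U> = A" "k = size \<U>"
    using assms unfolding lengths_def by blast
  from U(1) have "2 * size \<U> \<le> size (\<Sum>\<^sub># \<U>) + count (\<Sum>\<^sub># \<U>) \<one> \<and>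
      size (\<Sum>\<^sub># \<U>) + (order G - 1) * count (\<Sum>\<^sub># \<U>) \<one> \<le> order G * size \<U>"
  proof (induction \<U>)
    case (add W \<U>)
    then show ?case
      using minimal_zero_sum_bounds[of W] by (auto simp: algebra_simps)
  qed simp
  with U show "2 * k \<le> size A + count A \<one>"
    and "size A + (order G - 1) * count A \<one> \<le> order G * k"
    by auto
qed

lemma finite_lengths: "finite (lengths A)"
proof (rule finite_subset)
  show "lengths A \<subseteq> {..size A + count A \<one>}"
  proof
    fix k assume "k \<in> lengths A"
    from lengths_bounds(1)[OF this] show "k \<in> {..size A + count A \<one>}" by simp
  qed
qed simp

lemma sym_power_count_one:
  assumes "set_mset D \<subseteq> generators"
  shows "count (sym_power D) \<one> = 0"
proof -
  have "\<one> \<notin># sym_power D"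
    using set_sym_power[OF assms] generator_neq_one by blast
  then show ?thesis
    by (simp add: not_in_iff)
qed

lemma two_mem_lengths_sym_power_singleton:
  assumes "g \<in> generators"
  shows "2 \<in> lengths (sym_power {#g#})"
proof -
  let ?\<U> = "{#replicate_mset (order G) g, replicate_mset (order G) (inv g)#}"
  have "size ?\<U> \<in> lengths (\<Sum>\<^sub># ?\<U>)"
    by (rule lengthsI)
      (use minimal_zero_sum_generator_power[OF assms]
        minimal_zero_sum_generator_power[OF inv_generator[OF assms]] in auto)
  then show ?thesis
    by (simp add: numeral_2_eq_2)
qed

lemma order_mem_lengths_sym_power_singleton:
  assumes "g \<in> generators"
  shows "order G \<in> lengths (sym_power {#g#})"
proof -
  have sum: "\<Sum>\<^sub># (replicate_mset k {#g, inv g#}) =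
      replicate_mset k g + replicate_mset k (inv g)" for k
    by (induction k) auto
  have "minimal_zero_sum {#g, inv g#}"
    using assms generator_neq_one[OF assms] minimal_zero_sum_pair by blast
  then have "size (replicate_mset (order G) {#g, inv g#})
      \<in> lengths (\<Sum>\<^sub># (replicate_mset (order G) {#g, inv g#}))"
    by (intro lengthsI) (simp split: if_splits)
  then show ?thesis
    by (simp add: sum)
qed

lemma extreme_lengths_sym_power:
  assumes "set_mset D \<subseteq> generators"
  shows "2 * size D \<in> lengths (sym_power D)" "order G * size D \<in> lengths (sym_power D)"
proof -
  have "2 * size D \<in> lengths (sym_power D) \<and> order G * size D \<in> lengths (sym_power D)"
    using assms
  proof (induction D)
    case (add g D)
    then have g: "g \<in> generators" by simp
    have IH: "2 * size D \<in> lengths (sym_power D)" "order G * size D \<in> lengths (sym_power D)"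
      using add by auto
    show ?case
      using lengths_plus[OF two_mem_lengths_sym_power_singleton[OF g] IH(1)]
        lengths_plus[OF order_mem_lengths_sym_power_singleton[OF g] IH(2)]
      by simp
  qed (simp add: lengths_empty)
  then show "2 * size D \<in> lengths (sym_power D)" "order G * size D \<in> lengths (sym_power D)"
    by auto
qed

lemma
  assumes "set_mset D \<subseteq> generators"
  shows Min_lengths_sym_power: "Min (lengths (sym_power D)) = 2 * size D"
    and Max_lengths_sym_power: "Max (lengths (sym_power D)) = order G * size D"
proof -
  note count = sym_power_count_one[OF assms]
  show "Min (lengths (sym_power D)) = 2 * size D"
  proof (rule Min_eqI)
    fix k assume "k \<in> lengths (sym_power D)"
    from lengths_bounds(2)[OF this] have "order G * (2 * size D) \<le> order G * k"
      using count by (simp add: size_sym_power mult_ac)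
    then show "2 * size D \<le> k"
      using order_ge_3 by simp
  qed (use extreme_lengths_sym_power[OF assms] finite_lengths in auto)
  show "Max (lengths (sym_power D)) = order G * size D"
  proof (rule Max_eqI)
    fix k assume "k \<in> lengths (sym_power D)"
    from lengths_bounds(1)[OF this] show "k \<le> order G * size D"
      using count by (simp add: size_sym_power)
  qed (use extreme_lengths_sym_power[OF assms] finite_lengths in auto)
qed

lemma elasticity_sym_power:
  assumes "set_mset D \<subseteq> generators" "D \<noteq> {#}"
  shows "elasticity (lengths (sym_power D)) = real (order G) / 2"
  using assms
  by (simp add: elasticity_def Min_lengths_sym_power Max_lengths_sym_power)

lemma zero_sum_sym_power:
  assumes "set_mset D \<subseteq> generators"
  shows "zero_sum (sym_power D)"
proof -
  obtain \<U> where "\<forall>W\<in>#\<U>. minimal_zero_sum W" "\<Sum>\<^sub># \<U> = sym_power D"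
    using extreme_lengths_sym_power(1)[OF assms] unfolding lengths_def by blast
  then show ?thesis
    using zero_sum_sum_mset[of \<U>] by auto
qed

text \<open>
  A longest factorization bounds the number of terms from below and a shortest one bounds it
  from above. Each occurrence of the identity costs the amount \<open>n - 2\<close> in the comparison, so in
  the case of equality the identity does not occur.
\<close>

lemma elasticity_bounds:
  assumes "zero_sum A"
  shows "2 * Max (lengths A) \<le> order G * Min (lengths A)"
    and "2 * Max (lengths A) = order G * Min (lengths A) \<Longrightarrow>
      size A = order G * Min (lengths A) \<and> count A \<one> = 0"
proof -
  let ?m = "Min (lengths A)" and ?M = "Max (lengths A)" and ?c = "count A \<one>"
  have "?M \<in> lengths A" "?m \<in> lengths A"
    using lengths_nonempty[OF assms] finite_lengths by auto
  then have bounds: "2 * ?M \<le> size A + ?c" "size A + (order G - 1) * ?c \<le> order G * ?m"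
    using lengths_bounds by auto
  have "order G - 1 = (order G - 2) + 1"
    using order_ge_3 by simp
  then have "(order G - 1) * ?c = (order G - 2) * ?c + ?c"
    by (simp only: add_mult_distrib mult_1)
  then have *: "2 * ?M + (order G - 2) * ?c \<le> order G * ?m"
    using bounds by linarith
  then show "2 * ?M \<le> order G * ?m" by linarith
  assume eq: "2 * ?M = order G * ?m"
  then have "?c = 0"
    using * order_ge_3 by simp
  then show "size A = order G * ?m \<and> ?c = 0"
    using bounds eq by simp
qed

lemma elasticity_le:
  assumes "zero_sum A"
  shows "elasticity (lengths A) \<le> real (order G) / 2"
proof (cases "Min (lengths A) = 0")
  case False
  have "2 * real (Max (lengths A)) \<le> real (order G) * real (Min (lengths A))"
    using of_nat_mono[OF elasticity_bounds(1)[OF assms], where 'a = real]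
    by (simp only: of_nat_mult of_nat_numeral)
  then show ?thesis
    using False by (simp add: elasticity_def field_simps)
qed (simp add: elasticity_def)

lemma monoid_elasticity_zero_sum_monoid:
  "monoid_elasticity (zero_sum_monoid G) = ereal (real (order G) / 2)"
proof (rule antisym)
  show "monoid_elasticity (zero_sum_monoid G) \<le> ereal (real (order G) / 2)"
    unfolding monoid_elasticity_def
  proof (rule SUP_least)
    fix A assume "A \<in> carrier (zero_sum_monoid G) - Units (zero_sum_monoid G)"
    then have "zero_sum A" by (simp add: zero_sum_def)
    then show "ereal (elasticity (length_set (zero_sum_monoid G) A)) \<le> ereal (real (order G) / 2)"
      using elasticity_le by (simp add: length_set_zero_sum_monoid)
  qed
  obtain g where "g \<in> generators" using generator_exists by blast
  then have D: "set_mset {#g#} \<subseteq> generators" by simp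
  have A: "zero_sum (sym_power {#g#})" by (rule zero_sum_sym_power[OF D])
  have "sym_power {#g#} \<noteq> {#}"
    using order_ge_3 by auto
  then have "sym_power {#g#} \<in> carrier (zero_sum_monoid G) - Units (zero_sum_monoid G)"
    using A unfolding Units_zero_sum_monoid by (simp add: zero_sum_def)
  then have "ereal (elasticity (length_set (zero_sum_monoid G) (sym_power {#g#})))
      \<le> monoid_elasticity (zero_sum_monoid G)"
    unfolding monoid_elasticity_def by (rule SUP_upper)
  then show "ereal (real (order G) / 2) \<le> monoid_elasticity (zero_sum_monoid G)"
    using A D by (simp add: length_set_zero_sum_monoid elasticity_sym_power del: sym_power_add_mset)
qed

text \<open>
  Equality in the comparison above makes every atom of a shortest factorization as long as
  possible, hence a power of a generator, and every atom of a longest factorization of length two,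
  hence a pair \<open>g (inv g)\<close>. So the exponents in the first factorization are invariant under
  inversion, and its atoms can be paired, no generator being its own inverse.
\<close>

proposition maximal_elasticity_imp_sym_power:
  assumes A: "zero_sum A" and elast: "elasticity (lengths A) = real (order G) / 2"
  obtains D where "set_mset D \<subseteq> generators" "D \<noteq> {#}" "A = sym_power D"
proof -
  let ?m = "Min (lengths A)" and ?M = "Max (lengths A)"
  have mem: "?M \<in> lengths A" "?m \<in> lengths A"
    using lengths_nonempty[OF A] finite_lengths by auto
  have "?m \<noteq> 0"
  proof
    assume "?m = 0"
    then have "elasticity (lengths A) = 0"
      by (simp add: elasticity_def)
    then show False
      using elast order_ge_3 by simp
  qed
  then have "2 * real ?M = real (order G) * real ?m"
    using elast by (simp add: elasticity_def field_simps)
  then have "real (2 * ?M) = real (order G * ?m)"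
    by (simp only: of_nat_mult of_nat_numeral)
  then have eq: "2 * ?M = order G * ?m"
    by (rule of_nat_eq_iff[THEN iffD1])
  note size = elasticity_bounds(2)[OF A eq]

  obtain \<U> where U: "\<forall>W\<in>#\<U>. minimal_zero_sum W" "\<Sum>\<^sub># \<U> = A" "?m = size \<U>"
    using mem(2) unfolding lengths_def by blast
  have size_W: "size W = order G" if "W \<in># \<U>" for W
  proof (rule sum_mset_eq_upper_bound[where M = \<U>])
    show "(\<Sum>W\<in>#\<U>. size W) = order G * size \<U>"
      using size U by (metis size_mset_sum_mset_conv)
  qed (use U size_minimal_zero_sum_le_order[OF finite_carrier] that in auto)
  have "\<exists>g\<in>generators. W = replicate_mset (order G) g" if W: "W \<in># \<U>" for W
  proof -
    have "minimal_zero_sum W"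
      using U(1) W by blast
    from minimal_zero_sum_of_size_order[OF order_ge_3 this size_W[OF W]] show ?thesis
      by blast
  qed
  then have "\<exists>C. set_mset C \<subseteq> generators \<and> \<U> = image_mset (replicate_mset (order G)) C"
  proof (induction \<U>)
    case (add W \<U>)
    obtain C where "set_mset C \<subseteq> generators" "\<U> = image_mset (replicate_mset (order G)) C"
      using add.IH add.prems by fastforce
    moreover obtain g where "g \<in> generators" "W = replicate_mset (order G) g"
      using add.prems[of W] by auto
    ultimately show ?case
      by (intro exI[of _ "add_mset g C"]) auto
  qed simp
  then obtain C where C: "set_mset C \<subseteq> generators" "A = (\<Sum>g\<in>#C. replicate_mset (order G) g)"
    using U by blast
  have count: "count A x = order G * count C x" for x
    unfolding C(2) by (induction C) auto

  obtain \<V> where V: "\<forall>W\<in>#\<V>. minimal_zero_sum W" "\<Sum>\<^sub># \<V> = A" "?M = size \<V>"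
    using mem(1) unfolding lengths_def by blast
  have size_2: "size W = 2" if "W \<in># \<V>" for W
  proof (rule sum_mset_eq_lower_bound[where M = \<V>])
    show "(\<Sum>W\<in>#\<V>. size W) = 2 * size \<V>"
      using size V eq by (metis size_mset_sum_mset_conv)
    fix W assume "W \<in># \<V>"
    then have "W \<subseteq># A"
      using V member_subset_sum_mset by blast
    then have "count W \<one> = 0"
      using size mset_subset_eq_count[of W A \<one>] by simp
    then show "2 \<le> size W"
      using minimal_zero_sum_bounds(1)[of W] V \<open>W \<in># \<V>\<close> by simp
  qed (use that in auto)
  have "symmetric W" if "W \<in># \<V>" for W
    using V(1) that symmetric_zero_sum_size_2[OF minimal_zero_sum_imp_zero_sum size_2] by blast
  then have "symmetric A"
    unfolding V(2)[symmetric] by (rule symmetric_sum_mset)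
  then have "symmetric C"
    using order_ge_3 unfolding symmetric_def count by (metis mult_cancel1 not_numeral_le_zero)
  then obtain D where D: "set_mset D \<subseteq> generators" "C = D + image_mset (m_inv G) D"
    using symmetric_decompose C by blast
  have "A = sym_power D"
    unfolding C(2) D(2) sym_power_def by (simp add: sum_mset.distrib multiset.map_comp comp_def)
  moreover have "D \<noteq> {#}"
    using \<open>?m \<noteq> 0\<close> calculation by (auto simp: lengths_empty)
  ultimately show ?thesis
    using that D by blast
qed

section \<open>The length below the maximum\<close>

text \<open>
  Both sides are the unique element of order two: a generator is an odd power \<open>k\<close> of any other
  generator, and \<open>k n / 2\<close> differs from \<open>n / 2\<close> by a multiple of \<open>n\<close>.
\<close>

lemma generator_half_power:
  assumes "even (order G)" and g: "g \<in> generators" and h: "h \<in> generators"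
  shows "h [^] (order G div 2) = g [^] (order G div 2)"
proof -
  define m where "m = order G div 2"
  have n: "order G = 2 * m"
    using assms(1) by (simp add: m_def)
  have "generate G {g} \<subseteq> carrier G"
    using generate_incl[of "{g}"] g by simp
  moreover have "card (generate G {g}) = card (carrier G)"
    using g generate_pow_card[of g] by (simp add: order_def)
  ultimately have "generate G {g} = carrier G"
    by (intro card_subset_eq finite_carrier)
  then have "h \<in> {g [^] k | k. k \<in> (UNIV :: nat set)}"
    using generate_pow_nat[of g] g h order_ge_3 by simp
  then obtain k :: nat where k: "h = g [^] k" by blast
  have "odd k"
  proof
    assume "even k"
    then obtain j where "k = 2 * j" by blast
    then have "k * m = order G * j"
      using n by simp
    then have "h [^] m = \<one>"
      using g by (simp add: k nat_pow_pow pow_eq_id)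
    then have "order G dvd m"
      using h pow_eq_id[of h m] by simp
    then show False
      using n order_ge_3 by (auto dest: dvd_imp_le)
  qed
  then obtain j where "k = 2 * j + 1" by (rule oddE)
  then have exponent: "k * m = order G * j + m"
    using n by simp
  have gC: "g \<in> carrier G" and one: "g [^] (order G * j) = \<one>"
    using g by (auto simp: pow_eq_id)
  have "h [^] m = g [^] (order G * j) \<otimes> g [^] m"
    using gC by (simp add: k nat_pow_pow exponent nat_pow_mult)
  then have "h [^] m = g [^] m"
    using gC by (simp add: one)
  then show ?thesis
    by (simp add: m_def)
qed

text \<open>
  The \<open>n / 2\<close>-th power maps every term to the same element of order two, and maps the
  sum of the sequence to the identity.
\<close>

lemma even_size_zero_sum:
  assumes "even (order G)" "zero_sum S" "set_mset S \<subseteq> generators"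
  shows "even (size S)"
proof -
  define m where "m = order G div 2"
  have n: "order G = 2 * m"
    using assms(1) by (simp add: m_def)
  obtain g where g: "g \<in> generators"
    using generator_exists by blast
  have gC: "g \<in> carrier G" using g by simp
  have "seq_sum G S [^] m = g [^] (m * size S)"
    using assms(3)
  proof (induction S)
    case (add h S)
    then have h: "h \<in> generators" and S: "set_mset S \<subseteq> carrier G" by auto
    have "h [^] m = g [^] m"
      unfolding m_def by (rule generator_half_power[OF assms(1) g h])
    then have "seq_sum G (add_mset h S) [^] m = g [^] m \<otimes> g [^] (m * size S)"
      using add h S by (simp add: seq_sum_add_mset seq_sum_closed nat_pow_distrib)
    then show ?case
      using gC by (simp add: nat_pow_mult)
  qed (simp add: seq_sum_empty)
  then have "g [^] (m * size S) = \<one>"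
    using assms(2) by (simp add: zero_sum_def)
  then have "order G dvd m * size S"
    using g by (simp add: pow_eq_id)
  then have "2 * m dvd size S * m"
    by (simp add: n mult.commute)
  then show ?thesis
    using n order_ge_3 by simp
qed

text \<open>
  The sequence has \<open>2 (k + 1)\<close> terms, so in a factorization into \<open>k\<close> atoms the lengths
  exceed two by a total of only two. By parity a single atom \<open>W\<close> carries this excess. The
  other atoms are pairs of inverses, so \<open>W\<close> is invariant under inversion, like the whole
  sequence, and properly contains such a pair.
\<close>

proposition penultimate_notin_lengths_sym_power:
  assumes even: "even (order G)" and D: "set_mset D \<subseteq> generators"
    and k: "Suc k = order G * size D"
  shows "k \<notin> lengths (sym_power D)"
proof
  assume "k \<in> lengths (sym_power D)"
  then obtain \<U> where U: "\<forall>W\<in>#\<U>. minimal_zero_sum W" "\<Sum>\<^sub># \<U> = sym_power D" "k = size \<U>"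
    unfolding lengths_def by blast
  have total: "(\<Sum>W\<in>#\<U>. size W) = 2 * size \<U> + 2"
    using size_sym_power[of D] k U(2,3) by (metis size_mset_sum_mset_conv add_mult_distrib2 mult.assoc
        mult_Suc_right add.commute)
  have terms: "set_mset W \<subseteq> generators" if "W \<in># \<U>" for W
  proof -
    have "W \<subseteq># sym_power D"
      using U(2) that member_subset_sum_mset by metis
    then show ?thesis
      using set_sym_power[OF D] set_mset_mono by blast
  qed
  have size_ge_2: "2 \<le> size W" if "W \<in># \<U>" for W
  proof -
    have "\<one> \<notin># W"
      using terms[OF that] generator_neq_one by blast
    then show ?thesis
      using minimal_zero_sum_bounds(1)[of W] U(1) that by (simp add: not_in_iff)
  qed
  have "\<exists>W\<in>#\<U>. size W \<noteq> 2"
  proof (rule ccontr)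
    assume "\<not> ?thesis"
    then have "(\<Sum>W\<in>#\<U>. size W) = (\<Sum>W\<in>#\<U>. 2)"
      by (intro arg_cong[of _ _ sum_mset] image_mset_cong) auto
    then show False
      using total by simp
  qed
  then obtain W where W: "W \<in># \<U>" "size W \<noteq> 2" by blast
  have W_min: "minimal_zero_sum W"
    using U(1) W(1) by blast
  have "even (size W)"
    using even_size_zero_sum[OF even] minimal_zero_sum_imp_zero_sum[OF W_min] terms[OF W(1)] by blast
  then have size_W: "4 \<le> size W"
    using size_ge_2[OF W(1)] W(2) by presburger
  obtain \<R> where R: "\<U> = add_mset W \<R>"
    using W(1) by (metis insert_DiffM)
  have "(\<Sum>V\<in>#\<R>. 2) \<le> (\<Sum>V\<in>#\<R>. size V)"
    using size_ge_2 R by (intro sum_mset_mono) auto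
  then have sum_R: "(\<Sum>V\<in>#\<R>. size V) = 2 * size \<R>"
    using total size_W R by simp
  \<comment> \<open>The atom \<open>W\<close> has at least two terms in excess, which is the whole excess available.\<close>
  have "size V = 2" if "V \<in># \<R>" for V
    by (rule sum_mset_eq_lower_bound[OF _ sum_R that]) (use size_ge_2 R in auto)
  then have "symmetric (\<Sum>\<^sub># \<R>)"
    using U(1) R symmetric_zero_sum_size_2 minimal_zero_sum_imp_zero_sum
    by (intro symmetric_sum_mset) auto
  moreover have "\<Sum>\<^sub># \<R> + W = sym_power D"
    using U(2) R by (simp add: add.commute)
  ultimately have sym: "symmetric W"
    using symmetric_cancel symmetric_sym_power[OF D] by metis
  obtain g where gW: "g \<in># W"
    using minimal_zero_sum_nonempty[OF W_min] by blast
  then have g: "g \<in> generators" using terms[OF W(1)] by blast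
  have "count W (inv g) = count W g"
    using sym g unfolding symmetric_def by (metis mem_Collect_eq)
  then have "inv g \<in># W"
    using gW by (metis count_eq_zero_iff)
  have sub: "{#g, inv g#} \<subseteq># W"
  proof -
    obtain W' where "W = add_mset g W'"
      using gW by (metis insert_DiffM)
    with \<open>inv g \<in># W\<close> show ?thesis
      using generator_neq_inv[OF g] by simp
  qed
  have "zero_sum {#g, inv g#}"
    using zero_sum_pair g by blast
  from minimal_zero_sumD[OF W_min sub this] have "W = {#g, inv g#}"
    by simp
  then have "size W = 2" by simp
  then show False
    using W(2) by blast
qed

section \<open>Intervals of lengths when the order plus one is composite\<close>

text \<open>
  With \<open>h = g\<^sup>a\<close> and \<open>g = h\<^sup>b\<close>, the product \<open>g\<^sup>n h\<^sup>n\<close> of two atoms is the product of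
  the three sequences \<open>g\<^bsup>n - a\<^esup> h\<close>, \<open>h\<^bsup>n - b\<^esup> g\<close> and \<open>g\<^bsup>a - 1\<^esup> h\<^bsup>b - 1\<^esup>\<close>. Expressed as powers
  of \<open>g\<close>, of \<open>h\<close> and of \<open>g\<close>, respectively, their terms have positive exponents with sum exactly
  \<open>n\<close>; for the third one this is the equation \<open>(a - 1) + (b - 1) a = a b - 1 = n\<close>. So all three
  are atoms.
\<close>

lemma four_five_mem_lengths:
  assumes g: "g \<in> generators" and ab: "a * b = order G + 1" "1 < a" "1 < b"
  shows "g [^] a \<in> generators"
    and "4 \<in> lengths (sym_power {#g, g [^] a#})"
    and "5 \<in> lengths (sym_power {#g, g [^] a#})"
proof -
  define h where "h = g [^] a"
  let ?n = "order G"
  have gC: "g \<in> carrier G" and hC: "h \<in> carrier G" and ord_g: "ord g = ?n"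
    using g by (auto simp: h_def)
  have "g [^] (?n + 1) = g"
    using gC by (simp add: pow_order_eq_1)
  then have hb: "h [^] b = g"
    using gC ab(1) by (simp add: h_def nat_pow_pow)
  have "g [^] ord h = h [^] (b * ord h)"
    using hC by (simp add: nat_pow_pow flip: hb)
  also have "\<dots> = \<one>"
    using pow_eq_id[OF hC] by simp
  finally have "?n dvd ord h"
    using pow_eq_id[OF gC] ord_g by simp
  moreover have "ord h dvd ?n"
    by (rule ord_dvd_group_order[OF hC])
  ultimately have h: "h \<in> generators"
    using hC by (simp add: dvd_antisym)
  then show "g [^] a \<in> generators"
    by (simp only: h_def)
  have D: "set_mset {#g, h#} \<subseteq> generators"
    using g h by simp
  show "4 \<in> lengths (sym_power {#g, g [^] a#})"
    using extreme_lengths_sym_power(1)[OF D] by (simp add: h_def)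

  have "2 * b \<le> a * b" "a * 2 \<le> a * b"
    by (intro mult_le_mono; use ab in simp)+
  then have le: "a \<le> ?n" "b \<le> ?n"
    using ab by linarith+
  let ?U1 = "replicate_mset (?n - a) g + {#h#}"
  let ?U2 = "replicate_mset (?n - b) h + {#g#}"
  let ?U3 = "replicate_mset (a - 1) g + replicate_mset (b - 1) h"
  have "minimal_zero_sum (image_mset (\<lambda>i. g [^] i) (replicate_mset (?n - a) 1 + {#a#}))"
    using gC ord_g le ab order_ge_3 by (intro minimal_zero_sum_index_one) (auto split: if_splits)
  then have U1: "minimal_zero_sum ?U1"
    using gC by (simp add: h_def)
  have "minimal_zero_sum (image_mset (\<lambda>i. h [^] i) (replicate_mset (?n - b) 1 + {#b#}))"
    using h le ab order_ge_3 by (intro minimal_zero_sum_index_one) (auto split: if_splits)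
  then have U2: "minimal_zero_sum ?U2"
    using hC by (simp add: hb)
  have "(a - 1) + (b - 1) * a = ?n"
    using ab by (cases b) (auto simp: algebra_simps)
  then have "minimal_zero_sum
      (image_mset (\<lambda>i. g [^] i) (replicate_mset (a - 1) 1 + replicate_mset (b - 1) a))"
    using gC ord_g ab order_ge_3 by (intro minimal_zero_sum_index_one) (auto split: if_splits)
  then have U3: "minimal_zero_sum ?U3"
    using gC by (simp add: h_def)
  let ?\<U> = "{#?U1, ?U2, ?U3, replicate_mset ?n (inv g), replicate_mset ?n (inv h)#}"
  have "size ?\<U> \<in> lengths (\<Sum>\<^sub># ?\<U>)"
    by (rule lengthsI) (use U1 U2 U3 minimal_zero_sum_generator_power inv_generator g h in auto)
  moreover have "\<Sum>\<^sub># ?\<U> = sym_power {#g, h#}"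
  proof -
    have split: "replicate_mset ?n x = replicate_mset (?n - c) x + {#x#} + replicate_mset (c - 1) x"
      if "1 < c" "c \<le> ?n" for x c
      using that by (intro multiset_eqI) auto
    show ?thesis
      using split[of a g] split[of b h] le ab
      by (simp add: ac_simps)
  qed
  moreover have "size ?\<U> = 5"
    by simp
  ultimately have "5 \<in> lengths (sym_power {#g, h#})"
    by (simp only:)
  then show "5 \<in> lengths (sym_power {#g, g [^] a#})"
    by (simp only: h_def)
qed

text \<open>
  The sequence \<open>E\<close> consists of \<open>n\<close> copies of \<open>g\<close> and of \<open>h\<close>; each copy of the two blocks can be
  factored into four or five atoms, which yields all lengths from \<open>4 n\<close> to \<open>5 n\<close>. A further
  block shifts the interval of lengths reached so far by \<open>2\<close> or by \<open>n\<close>, and the two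
  shifted intervals overlap, since the interval has more than \<open>n - 2\<close> elements.
\<close>

proposition interval_lengths:
  assumes "\<not> Factorial_Ring.prime (order G + 1)"
  obtains E where "set_mset E \<subseteq> generators" "size E = 2 * order G"
    "\<And>D. set_mset D \<subseteq> generators \<Longrightarrow>
      {4 * order G + 2 * size D .. 5 * order G + order G * size D} \<subseteq> lengths (sym_power (E + D))"
proof -
  let ?n = "order G"
  obtain a where a: "a dvd ?n + 1" "a \<noteq> 1" "a \<noteq> ?n + 1"
    using assms order_ge_3 by (auto simp: prime_nat_iff)
  then obtain b where ab: "a * b = ?n + 1" by (metis dvdE)
  then have ab_gt: "1 < a" "1 < b"
    using a order_ge_3 by (metis Suc_eq_plus1 add_is_0 less_one linorder_neqE_nat mult.right_neutral
        mult_is_0 one_neq_zero)+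
  obtain g where g: "g \<in> generators"
    using generator_exists by blast
  define h where "h = g [^] a"
  have h: "h \<in> generators" and four_five: "4 \<in> lengths (sym_power {#g, h#})"
    "5 \<in> lengths (sym_power {#g, h#})"
    using four_five_mem_lengths[OF g ab ab_gt] by (simp_all only: h_def)
  define E where "E K = replicate_mset K g + replicate_mset K h" for K
  have E_Suc: "sym_power (E (Suc K)) = sym_power {#g, h#} + sym_power (E K)" for K
    by (simp add: E_def sym_power_plus ac_simps)
  have base: "4 * K + j \<in> lengths (sym_power (E K))" if "j \<le> K" for K j
    using that
  proof (induction K arbitrary: j)
    case 0
    then show ?case by (simp add: E_def lengths_empty)
  next
    case (Suc K)
    show ?case
    proof (cases j)
      case 0
      have "4 + (4 * K + 0) \<in> lengths (sym_power (E (Suc K)))"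
        unfolding E_Suc by (intro lengths_plus four_five Suc.IH) simp
      then show ?thesis
        by (simp add: 0)
    next
      case (Suc i)
      have "5 + (4 * K + i) \<in> lengths (sym_power (E (Suc K)))"
        unfolding E_Suc by (intro lengths_plus four_five Suc.IH) (use Suc Suc.prems in simp)
      then show ?thesis
        by (simp add: Suc)
    qed
  qed
  have "{4 * ?n + 2 * size D .. 5 * ?n + ?n * size D} \<subseteq> lengths (sym_power (E ?n + D))"
    if "set_mset D \<subseteq> generators" for D
    using that
  proof (induction D)
    case empty
    show ?case
    proof
      fix l assume "l \<in> {4 * ?n + 2 * size {#} .. 5 * ?n + ?n * size {#}}"
      then show "l \<in> lengths (sym_power (E ?n + {#}))"
        using base[of "l - 4 * ?n" ?n] by auto
    qed
  next
    case (add x D)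
    then have x: "x \<in> generators" by simp
    have IH: "l \<in> lengths (sym_power (E ?n + D))"
      if "4 * ?n + 2 * size D \<le> l" "l \<le> 5 * ?n + ?n * size D" for l
      using add that by auto
    have split: "sym_power (E ?n + add_mset x D) = sym_power {#x#} + sym_power (E ?n + D)"
      by (simp add: ac_simps)
    show ?case
    proof
      fix l assume "l \<in> {4 * ?n + 2 * size (add_mset x D) .. 5 * ?n + ?n * size (add_mset x D)}"
      then have l: "4 * ?n + 2 * size D + 2 \<le> l" "l \<le> 5 * ?n + ?n * size D + ?n"
        by simp_all
      show "l \<in> lengths (sym_power (E ?n + add_mset x D))"
      proof (cases "l \<le> 5 * ?n + ?n * size D + 2")
        case True
        then have "l - 2 \<in> lengths (sym_power (E ?n + D))"
          using l by (intro IH) auto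
        then have "2 + (l - 2) \<in> lengths (sym_power (E ?n + add_mset x D))"
          unfolding split by (intro lengths_plus two_mem_lengths_sym_power_singleton x)
        moreover have "2 + (l - 2) = l"
          using l by simp
        ultimately show ?thesis
          by (simp only:)
      next
        case False
        have "2 * size D \<le> ?n * size D"
          using order_ge_3 by simp
        then have "4 * ?n + 2 * size D + ?n \<le> l"
          using False by linarith
        then have "l - ?n \<in> lengths (sym_power (E ?n + D))"
          using l by (intro IH) simp_all
        then have "?n + (l - ?n) \<in> lengths (sym_power (E ?n + add_mset x D))"
          unfolding split by (intro lengths_plus order_mem_lengths_sym_power_singleton x)
        moreover have "?n + (l - ?n) = l"
          using l False by simp
        ultimately show ?thesis
          by (simp only:)
      qed
    qed
  qed
  moreover have "set_mset (E ?n) \<subseteq> generators" "size (E ?n) = 2 * ?n"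
    using g h by (auto simp: E_def split: if_splits)
  ultimately show ?thesis
    using that by blast
qed

end

section \<open>Transfer Krull monoids over cyclic groups\<close>

theorem theorem1p2:
  fixes G :: "'g monoid" and H :: "('a, 'b) monoid_scheme"
  assumes "group G" and "cyclic_group G"
    and "even (order G)" and "order G \<ge> 4"
    and "transfer_Krull_monoid_over H G"
  shows "(\<not> (\<exists>a\<in>carrier H.
            ereal (elasticity (length_set H a)) = monoid_elasticity H \<and>
            int (Max (length_set H a)) - 1 \<in> int ` length_set H a)) \<and>
         (\<not> Factorial_Ring.prime (order G + 1) \<longrightarrow>
           (\<exists>a'\<in>carrier H. \<exists>M :: nat. \<forall>a\<in>carrier H.
             ereal (elasticity (length_set H a)) = monoid_elasticity H \<longrightarrow>
             int_interval (int ` length_set H (a' \<otimes>\<^bsub>H\<^esub> a) \<inter>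
               {int (Min (length_set H (a' \<otimes>\<^bsub>H\<^esub> a))) ..
                int (Max (length_set H (a' \<otimes>\<^bsub>H\<^esub> a))) - int M}) \<and>
             ereal (elasticity (length_set H (a' \<otimes>\<^bsub>H\<^esub> a))) = monoid_elasticity H))"
proof -
  interpret cyclic_group_order_ge_3 G
    using assms by (auto simp: cyclic_group_order_ge_3_def cyclic_group_order_ge_3_axioms_def)
  let ?B = "zero_sum_monoid G" and ?n = "order G"
  obtain \<theta> where \<theta>: "transfer_homomorphism H ?B \<theta>"
    using assms(5) by (auto simp: transfer_Krull_monoid_over_def)
  have reduced: "Units ?B = {\<one>\<^bsub>?B\<^esub>}"
    by (simp add: Units_zero_sum_monoid)
  interpret H: atomic_monoid H
    using \<theta> by (simp add: transfer_homomorphism_def)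
  have zero_sum_\<theta>: "zero_sum (\<theta> a)" if "a \<in> carrier H" for a
    using transfer_closed[OF \<theta> reduced that] by (simp add: zero_sum_def)
  have length_set: "length_set H a = lengths (\<theta> a)" if "a \<in> carrier H" for a
    using transfer_length_set[OF \<theta> reduced that] zero_sum_\<theta>[OF that]
    by (simp add: length_set_zero_sum_monoid)
  have elasticity_H: "monoid_elasticity H = ereal (real ?n / 2)"
    using transfer_monoid_elasticity[OF \<theta> reduced] monoid_elasticity_zero_sum_monoid by simp
  have extremal: "\<exists>D. set_mset D \<subseteq> generators \<and> D \<noteq> {#} \<and> \<theta> a = sym_power D"
    if a: "a \<in> carrier H" and el: "ereal (elasticity (length_set H a)) = monoid_elasticity H" for a
  proof -
    have "elasticity (lengths (\<theta> a)) = real ?n / 2"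
      using a el by (simp add: elasticity_H length_set)
    then obtain D where "set_mset D \<subseteq> generators" "D \<noteq> {#}" "\<theta> a = sym_power D"
      by (rule maximal_elasticity_imp_sym_power[OF zero_sum_\<theta>[OF a]])
    then show ?thesis
      by (intro exI[of _ D] conjI)
  qed
  show ?thesis
  proof (intro conjI impI)
    show "\<not> (\<exists>a\<in>carrier H.
        ereal (elasticity (length_set H a)) = monoid_elasticity H \<and>
        int (Max (length_set H a)) - 1 \<in> int ` length_set H a)"
    proof safe
      fix a k assume a: "a \<in> carrier H"
        and el: "ereal (elasticity (length_set H a)) = monoid_elasticity H"
        and k: "int (Max (length_set H a)) - 1 = int k" "k \<in> length_set H a"
      obtain D where D: "set_mset D \<subseteq> generators" "\<theta> a = sym_power D"
        using extremal[OF a el] by blast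
      have "Suc k = Max (length_set H a)"
        using k(1) by linarith
      then have "k \<in> lengths (sym_power D)" "Suc k = ?n * size D"
        using k(2) Max_lengths_sym_power[OF D(1)] D(2) length_set[OF a] by simp_all
      then show False
        using penultimate_notin_lengths_sym_power[OF assms(3) D(1)] by blast
    qed
  next
    assume "\<not> Factorial_Ring.prime (?n + 1)"
    then obtain E where E: "set_mset E \<subseteq> generators" "size E = 2 * ?n"
      and interval: "\<And>D. set_mset D \<subseteq> generators \<Longrightarrow>
        {4 * ?n + 2 * size D .. 5 * ?n + ?n * size D} \<subseteq> lengths (sym_power (E + D))"
      using interval_lengths by blast
    have "sym_power E \<in> carrier ?B"
      using zero_sum_sym_power[OF E(1)] by (simp add: zero_sum_def)
    then obtain a' where a': "a' \<in> carrier H" "\<theta> a' = sym_power E"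
      by (rule transfer_surj[OF \<theta> reduced])
    \<comment> \<open>For \<open>d\<close> blocks in the image of \<open>a\<close>, the maximal length is \<open>n (2 n + d)\<close>, and the lengths
      known to form an interval end at \<open>5 n + n d\<close>.\<close>
    define M where "M = ?n * (2 * ?n) - 5 * ?n"
    have "5 * ?n \<le> (2 * ?n) * ?n"
      using assms(4) by (intro mult_right_mono) auto
    then have M: "int M = int (?n * (2 * ?n)) - int (5 * ?n)"
      by (simp add: M_def of_nat_diff mult.commute)
    show "\<exists>a'\<in>carrier H. \<exists>M :: nat. \<forall>a\<in>carrier H.
             ereal (elasticity (length_set H a)) = monoid_elasticity H \<longrightarrow>
             int_interval (int ` length_set H (a' \<otimes>\<^bsub>H\<^esub> a) \<inter>
               {int (Min (length_set H (a' \<otimes>\<^bsub>H\<^esub> a))) ..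
                int (Max (length_set H (a' \<otimes>\<^bsub>H\<^esub> a))) - int M}) \<and>
             ereal (elasticity (length_set H (a' \<otimes>\<^bsub>H\<^esub> a))) = monoid_elasticity H"
    proof (intro bexI[OF _ a'(1)] exI[of _ M] ballI impI)
      fix a assume a: "a \<in> carrier H"
        and el: "ereal (elasticity (length_set H a)) = monoid_elasticity H"
      obtain D where D: "set_mset D \<subseteq> generators" "D \<noteq> {#}" "\<theta> a = sym_power D"
        using extremal[OF a el] by blast
      define L where "L = lengths (sym_power (E + D))"
      have ED: "set_mset (E + D) \<subseteq> generators" "E + D \<noteq> {#}"
        using D E by auto
      have L: "length_set H (a' \<otimes>\<^bsub>H\<^esub> a) = L"
        using length_set[of "a' \<otimes>\<^bsub>H\<^esub> a"] a a' D transfer_mult[OF \<theta> reduced a'(1) a]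
        by (simp add: L_def sym_power_plus)
      have Min: "Min L = 4 * ?n + 2 * size D"
        using Min_lengths_sym_power[OF ED(1)] E(2) by (simp add: L_def)
      have "Max L = ?n * (2 * ?n) + ?n * size D"
        using Max_lengths_sym_power[OF ED(1)] E(2) by (simp add: L_def add_mult_distrib2)
      then have Max: "int (Max L) - int M = int (5 * ?n + ?n * size D)"
        using M by simp
      have "int ` L \<inter> {int (Min L) .. int (Max L) - int M} = {int (Min L) .. int (Max L) - int M}"
      proof -
        have "{int (Min L) .. int (Max L) - int M} \<subseteq> int ` L"
          unfolding Max Min
          using interval[OF D(1)] unfolding L_def[symmetric]
          by (metis image_int_atLeastAtMost image_mono)
        then show ?thesis by blast
      qed
      moreover have "int (Min L) \<le> int (Max L) - int M"
      proof -
        have "2 * size D \<le> ?n * size D"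
          using assms(4) by simp
        then show ?thesis
          unfolding Max Min by linarith
      qed
      ultimately have "int_interval (int ` L \<inter> {int (Min L) .. int (Max L) - int M})"
        unfolding int_interval_def by metis
      moreover have "ereal (elasticity L) = monoid_elasticity H"
        using elasticity_sym_power[OF ED] by (simp add: L_def elasticity_H)
      ultimately show "int_interval (int ` length_set H (a' \<otimes>\<^bsub>H\<^esub> a) \<inter>
               {int (Min (length_set H (a' \<otimes>\<^bsub>H\<^esub> a))) ..
                int (Max (length_set H (a' \<otimes>\<^bsub>H\<^esub> a))) - int M}) \<and>
             ereal (elasticity (length_set H (a' \<otimes>\<^bsub>H\<^esub> a))) = monoid_elasticity H"
        unfolding L by blast
    qed
  qed
qed

end
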